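(* Let $G$ be a group and $\phi$ an automorphism of $G$. If the generalized Alexander quandle $Q_{G,\phi}$ is connected and the endomorphism $1-\phi$ on the abelianization $G_{\rm ab}$ of $G$ is invertible, then there is an isomorphism of abelian groups $$H_2^Q(Q_{G,\phi}) \cong H_2(G)_{\phi}.$$
   Context: A quandle is a set $X$ with a binary operation $*$ such that (Q1) $x*x=x$ for all $x$; (Q2) for each $x\in X$ the map $s_x:X\to X$, $s_x(a)=a*x$, is bijective; (Q3) $(x*y)*z=(x*z)*(y*z)$ for all $x,y,z$. The inner-automorphism group ${\rm Inn}(X)$ is the group of permutations of $X$ generated by all $s_x$, with multiplication the opposite of composition, so that it acts on $X$ from the right. $X$ is connected if this action is transitive. The generalized Alexander quandle $Q_{G,\phi}$ is the set $G$ with operation $x*y=\phi(xy^{-1})y$. $H_2(G)=H_2(G,\mathbb{Z})$ is group homology with trivial coefficients; $\phi$ acts on $G_{\rm ab}$ (written additively) and on $H_2(G)$ by the induced automorphisms. For an abelian group $N$ with automorphism $\phi$, $N_\phi:=N/(1-\phi)N$. Quandle homology $H_*^Q(X)$ (with $\mathbb{Z}$ coefficients): let $C_n^R(X)$ be the free abelian group on $X^n$, with $$\partial(x_1,\dots,x_n)=\sum_{i=1}^n(-1)^i\bigl[(x_1,\dots,x_{i-1},x_{i+1},\dots,x_n)-(x_1*x_i,\dots,x_{i-1}*x_i,x_{i+1},\dots,x_n)\bigr].$$ Let $C_n^D(X)\subset C_n^R(X)$ be the subgroup spanned by tuples with $x_i=x_{i+1}$ for some $1\le i<n$ (zero for $n\le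 1$); it is a subcomplex. $H_*^Q(X)$ is the homology of $C_*^R(X)/C_*^D(X)$. *)

theory Defs
  imports "HOL-Algebra.Algebra"
begin

section \<open>Quandles\<close>

record 'a quandle = "'a partial_object" +
  qop :: "['a, 'a] \<Rightarrow> 'a"  (infixl \<open>\<triangleright>\<index>\<close> 70)

locale quandle =
  fixes Q (structure)
  assumes qop_closed: "\<lbrakk>x \<in> carrier Q; y \<in> carrier Q\<rbrakk> \<Longrightarrow> x \<triangleright> y \<in> carrier Q"
    and idem: "x \<in> carrier Q \<Longrightarrow> x \<triangleright> x = x"
    and right_bij: "x \<in> carrier Q \<Longrightarrow> bij_betw (\<lambda>a. a \<triangleright> x) (carrier Q) (carrier Q)"
    and right_distrib: "\<lbrakk>x \<in> carrier Q; y \<in> carrier Q; z \<in> carrier Q\<rbrakk>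
      \<Longrightarrow> (x \<triangleright> y) \<triangleright> z = (x \<triangleright> z) \<triangleright> (y \<triangleright> z)"

text \<open>\<open>BijGroup\<close> consists of extensional functions, so \<open>s\<^sub>x\<close> is restricted to the carrier.\<close>

definition symm :: "('a, 'b) quandle_scheme \<Rightarrow> 'a \<Rightarrow> 'a \<Rightarrow> 'a"
  where "symm Q x = (\<lambda>a \<in> carrier Q. a \<triangleright>\<^bsub>Q\<^esub> x)"

text \<open>The product of \<open>f\<close> and \<open>g\<close> in \<open>Inn\<close> is "first \<open>f\<close>, then \<open>g\<close>"; hence
  \<open>(x, f) \<mapsto> f x\<close> is a right action.\<close>

definition Inn :: "('a, 'b) quandle_scheme \<Rightarrow> ('a \<Rightarrow> 'a) monoid"
  where "Inn Q = (BijGroup (carrier Q))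
    \<lparr>carrier := generate (BijGroup (carrier Q)) (symm Q ` carrier Q),
     mult := (\<lambda>f g. g \<otimes>\<^bsub>BijGroup (carrier Q)\<^esub> f)\<rparr>"

locale connected_quandle = quandle +
  assumes transitive: "\<lbrakk>x \<in> carrier Q; y \<in> carrier Q\<rbrakk> \<Longrightarrow> \<exists>f \<in> carrier (Inn Q). f x = y"

definition gen_Alexander :: "('a, 'b) monoid_scheme \<Rightarrow> ('a \<Rightarrow> 'a) \<Rightarrow> 'a quandle"
  where "gen_Alexander G \<phi> =
    \<lparr>carrier = carrier G, qop = (\<lambda>x y. \<phi> (x \<otimes>\<^bsub>G\<^esub> inv\<^bsub>G\<^esub> y) \<otimes>\<^bsub>G\<^esub> y)\<rparr>"

lemma quandle_gen_Alexander:
  fixes G (structure)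
  assumes "group G" and phi: "\<phi> \<in> iso G G"
  shows "quandle (gen_Alexander G \<phi>)"
proof -
  interpret group G by fact
  have hom: "\<phi> \<in> hom G G" and bij: "bij_betw \<phi> (carrier G) (carrier G)"
    using phi by (auto simp: iso_def)
  interpret h: group_hom G G \<phi>
    using hom by unfold_locales
  have R: "bij_betw (\<lambda>a. a \<otimes> c) (carrier G) (carrier G)" if "c \<in> carrier G" for c
    using that by (intro bij_betw_byWitness[where f' = "\<lambda>a. a \<otimes> inv c"]) (auto simp: m_assoc)
  have bij_op: "bij_betw (\<lambda>a. \<phi> (a \<otimes> inv x) \<otimes> x) (carrier G) (carrier G)"
    if "x \<in> carrier G" for x
    using bij_betw_trans [OF bij_betw_trans [OF R bij] R, of "inv x" x] that by (simp add: comp_def)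
  have distrib: "\<phi> (\<phi> (x \<otimes> inv y) \<otimes> y \<otimes> inv z) \<otimes> z =
      \<phi> (\<phi> (x \<otimes> inv z) \<otimes> z \<otimes> inv (\<phi> (y \<otimes> inv z) \<otimes> z)) \<otimes> (\<phi> (y \<otimes> inv z) \<otimes> z)"
    if xyz: "x \<in> carrier G" "y \<in> carrier G" "z \<in> carrier G" for x y z
  proof -
    have "z \<otimes> inv (\<phi> (y \<otimes> inv z) \<otimes> z) = inv (\<phi> (y \<otimes> inv z))"
      using xyz by (simp add: inv_mult_group m_assoc [symmetric])
    also have "\<dots> = \<phi> (z \<otimes> inv y)"
      using xyz by (simp add: inv_mult_group flip: h.hom_inv)
    finally have "\<phi> (x \<otimes> inv z) \<otimes> z \<otimes> inv (\<phi> (y \<otimes> inv z) \<otimes> z) =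
        \<phi> (x \<otimes> inv z) \<otimes> \<phi> (z \<otimes> inv y)"
      using xyz by (simp add: m_assoc)
    also have "\<dots> = \<phi> (x \<otimes> inv y)"
      using xyz by (simp add: m_assoc flip: h.hom_mult) (simp flip: m_assoc)
    finally have "\<phi> (x \<otimes> inv z) \<otimes> z \<otimes> inv (\<phi> (y \<otimes> inv z) \<otimes> z) = \<phi> (x \<otimes> inv y)" .
    then show ?thesis
      using xyz by (simp add: m_assoc)
  qed
  show ?thesis
    unfolding quandle_def gen_Alexander_def using bij_op distrib by simp
qed


section \<open>Quotients, coinvariants and homology of chain complexes\<close>

text \<open>The homomorphism \<open>G Mod K \<rightarrow> H Mod L\<close>, \<open>K #> x \<mapsto> L #> f x\<close>, induced by a homomorphism
  \<open>f : G \<rightarrow> H\<close> with \<open>f ` K \<subseteq> L\<close>.\<close>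

definition Mod_map :: "('b, 'c) monoid_scheme \<Rightarrow> 'b set \<Rightarrow> ('a \<Rightarrow> 'b) \<Rightarrow> 'a set \<Rightarrow> 'b set"
  where "Mod_map H L f U = L <#>\<^bsub>H\<^esub> (f ` U)"

lemma Mod_map_r_coset:
  assumes "group G" "group H" "subgroup K G" "subgroup L H"
    and f: "f \<in> hom G H" "f ` K \<subseteq> L" and x: "x \<in> carrier G"
  shows "Mod_map H L f (K #>\<^bsub>G\<^esub> x) = L #>\<^bsub>H\<^esub> f x"
proof -
  interpret G: group G by fact
  interpret H: group H by fact
  interpret K: subgroup K G by fact
  interpret L: subgroup L H by fact
  interpret f: group_hom G H f using f by unfold_locales
  have "f (k \<otimes>\<^bsub>G\<^esub> x) = f k \<otimes>\<^bsub>H\<^esub> f x" if "k \<in> K" for k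
    using that x by simp
  then have "Mod_map H L f (K #>\<^bsub>G\<^esub> x) = (\<Union>l\<in>L. \<Union>k\<in>K. {l \<otimes>\<^bsub>H\<^esub> (f k \<otimes>\<^bsub>H\<^esub> f x)})"
    unfolding Mod_map_def set_mult_def r_coset_def by auto
  also have "\<dots> = (\<Union>l\<in>L. \<Union>k\<in>K. {(l \<otimes>\<^bsub>H\<^esub> f k) \<otimes>\<^bsub>H\<^esub> f x})"
    using x by (simp add: H.m_assoc)
  also have "\<dots> = L #>\<^bsub>H\<^esub> f x"
  proof
    show "(\<Union>l\<in>L. \<Union>k\<in>K. {(l \<otimes>\<^bsub>H\<^esub> f k) \<otimes>\<^bsub>H\<^esub> f x}) \<subseteq> L #>\<^bsub>H\<^esub> f x"
      using f(2) unfolding r_coset_def by blast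
    show "L #>\<^bsub>H\<^esub> f x \<subseteq> (\<Union>l\<in>L. \<Union>k\<in>K. {(l \<otimes>\<^bsub>H\<^esub> f k) \<otimes>\<^bsub>H\<^esub> f x})"
      unfolding r_coset_def using K.one_closed by (force intro!: bexI[of _ "\<one>\<^bsub>G\<^esub>"])
  qed
  finally show ?thesis .
qed

text \<open>The endomorphism \<open>1 - f\<close> of an abelian group, which is written multiplicatively here.\<close>

definition one_minus :: "('a, 'b) monoid_scheme \<Rightarrow> ('a \<Rightarrow> 'a) \<Rightarrow> 'a \<Rightarrow> 'a"
  where "one_minus N f a = a \<otimes>\<^bsub>N\<^esub> inv\<^bsub>N\<^esub> (f a)"

definition coinvariants :: "('a, 'b) monoid_scheme \<Rightarrow> ('a \<Rightarrow> 'a) \<Rightarrow> 'a set monoid"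
  where "coinvariants N f = N Mod (one_minus N f ` carrier N)"

definition abelianization :: "('a, 'b) monoid_scheme \<Rightarrow> 'a set monoid"
  where "abelianization G = G Mod derived G (carrier G)"

definition abelianization_map :: "('a, 'b) monoid_scheme \<Rightarrow> ('a \<Rightarrow> 'a) \<Rightarrow> 'a set \<Rightarrow> 'a set"
  where "abelianization_map G f = Mod_map G (derived G (carrier G)) f"

text \<open>A chain complex is given by its groups \<open>C n\<close> and boundary maps \<open>d n : C n \<rightarrow> C (n - 1)\<close>;
  in degree 0 the boundary map must be trivial.\<close>

definition cycles :: "(nat \<Rightarrow> 'a monoid) \<Rightarrow> (nat \<Rightarrow> 'a \<Rightarrow> 'a) \<Rightarrow> nat \<Rightarrow> 'a monoid"
  where "cycles C d n = (C n)\<lparr>carrier := kernel (C n) (C (n - 1)) (d n)\<rparr>"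

definition boundaries :: "(nat \<Rightarrow> 'a monoid) \<Rightarrow> (nat \<Rightarrow> 'a \<Rightarrow> 'a) \<Rightarrow> nat \<Rightarrow> 'a set"
  where "boundaries C d n = d (Suc n) ` carrier (C (Suc n))"

definition homology :: "(nat \<Rightarrow> 'a monoid) \<Rightarrow> (nat \<Rightarrow> 'a \<Rightarrow> 'a) \<Rightarrow> nat \<Rightarrow> 'a set monoid"
  where "homology C d n = cycles C d n Mod boundaries C d n"

text \<open>The free abelian group on \<open>S\<^sup>n\<close>, with tuples represented by lists of length \<open>n\<close>.\<close>

definition tuple_chains :: "'a set \<Rightarrow> nat \<Rightarrow> ('a list \<Rightarrow>\<^sub>0 int) monoid"
  where "tuple_chains S n = free_Abelian_group {xs. length xs = n \<and> set xs \<subseteq> S}"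


section \<open>Group homology with trivial integer coefficients\<close>

text \<open>The complex obtained from the (unnormalized, inhomogeneous) bar resolution:
  \<open>[g\<^sub>1|\<dots>|g\<^sub>n]\<close> has boundary
  \<open>[g\<^sub>2|\<dots>|g\<^sub>n] + (\<Sum>i=1..n-1. (-1)\<^sup>i [g\<^sub>1|\<dots>|g\<^sub>i g\<^sub>i\<^sub>+\<^sub>1|\<dots>|g\<^sub>n]) + (-1)\<^sup>n [g\<^sub>1|\<dots>|g\<^sub>n\<^sub>-\<^sub>1]\<close>
  for \<open>n \<ge> 1\<close>. In the code the index \<open>i\<close> is shifted by one.\<close>

definition bar_boundary_tuple :: "('a, 'b) monoid_scheme \<Rightarrow> 'a list \<Rightarrow> ('a list \<Rightarrow>\<^sub>0 int)"
  where "bar_boundary_tuple G xs =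
    (if xs = [] then 0
     else frag_of (tl xs)
       + (\<Sum>i<length xs - 1. frag_cmul ((-1) ^ Suc i)
            (frag_of (take i xs @ [xs ! i \<otimes>\<^bsub>G\<^esub> xs ! Suc i] @ drop (Suc (Suc i)) xs)))
       + frag_cmul ((-1) ^ length xs) (frag_of (butlast xs)))"

definition group_homology :: "('a, 'b) monoid_scheme \<Rightarrow> nat \<Rightarrow> ('a list \<Rightarrow>\<^sub>0 int) set monoid"
  where "group_homology G n =
    homology (tuple_chains (carrier G)) (\<lambda>_. frag_extend (bar_boundary_tuple G)) n"

definition group_homology_map ::
    "('a, 'b) monoid_scheme \<Rightarrow> nat \<Rightarrow> ('a \<Rightarrow> 'a) \<Rightarrow> ('a list \<Rightarrow>\<^sub>0 int) set \<Rightarrow> ('a list \<Rightarrow>\<^sub>0 int) set"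
  where "group_homology_map G n f =
    Mod_map (cycles (tuple_chains (carrier G)) (\<lambda>_. frag_extend (bar_boundary_tuple G)) n)
      (boundaries (tuple_chains (carrier G)) (\<lambda>_. frag_extend (bar_boundary_tuple G)) n)
      (frag_extend (\<lambda>xs. frag_of (map f xs)))"


section \<open>Quandle homology\<close>

text \<open>List positions start at 0, so the summand for \<open>i\<close> is the one for \<open>i + 1\<close> in the usual
  formula.\<close>

definition rack_boundary_tuple :: "('a, 'b) quandle_scheme \<Rightarrow> 'a list \<Rightarrow> ('a list \<Rightarrow>\<^sub>0 int)"
  where "rack_boundary_tuple Q xs =
    (\<Sum>i<length xs. frag_cmul ((-1) ^ Suc i)
       (frag_of (take i xs @ drop (Suc i) xs)
        - frag_of (map (\<lambda>a. a \<triangleright>\<^bsub>Q\<^esub> xs ! i) (take i xs) @ drop (Suc i) xs)))"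

definition degenerate_chains :: "('a, 'b) quandle_scheme \<Rightarrow> nat \<Rightarrow> ('a list \<Rightarrow>\<^sub>0 int) set"
  where "degenerate_chains Q n =
    generate (tuple_chains (carrier Q) n)
      (frag_of ` {xs. length xs = n \<and> set xs \<subseteq> carrier Q \<and>
                      (\<exists>i. Suc i < n \<and> xs ! i = xs ! Suc i)})"

definition quandle_chains :: "('a, 'b) quandle_scheme \<Rightarrow> nat \<Rightarrow> ('a list \<Rightarrow>\<^sub>0 int) set monoid"
  where "quandle_chains Q n = tuple_chains (carrier Q) n Mod degenerate_chains Q n"

definition quandle_boundary ::
    "('a, 'b) quandle_scheme \<Rightarrow> nat \<Rightarrow> ('a list \<Rightarrow>\<^sub>0 int) set \<Rightarrow> ('a list \<Rightarrow>\<^sub>0 int) set"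
  where "quandle_boundary Q n =
    Mod_map (tuple_chains (carrier Q) (n - 1)) (degenerate_chains Q (n - 1))
      (frag_extend (rack_boundary_tuple Q))"

definition quandle_homology ::
    "('a, 'b) quandle_scheme \<Rightarrow> nat \<Rightarrow> ('a list \<Rightarrow>\<^sub>0 int) set set monoid"
  where "quandle_homology Q n = homology (quandle_chains Q) (quandle_boundary Q) n"

end

theory Submission
  imports Defs
begin

text \<open>The quandle \<open>Q\<close> has the underlying set of \<open>G\<close>, and both right translations of \<open>G\<close> and \<open>\<phi>\<close> are
  automorphisms of it. Modulo degenerate chains, \<open>H\<^sub>2(Q)\<close> is the group of 1-cycles of the graph with
  vertex set \<open>G\<close> and an edge \<open>(x, y)\<close> from \<open>x\<close> to \<open>x \<star> y\<close>, divided by one relation for each triple.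
  The relation of \<open>(x, y, z)\<close> says that moving an edge by \<open>_ \<star> z\<close> changes it by a chain that
  depends on the end points of the edge only. Hence \<open>_ \<star> z\<close> fixes the class of every cycle. In
  particular \<open>\<phi>\<close>, which is \<open>_ \<star> 1\<close>, does so, and because \<open>Q\<close> is connected, all translations do
  (\<open>phi_cycle\<close>, \<open>rtrans_cycle\<close>).

  From \<open>G\<close> to \<open>Q\<close>: connectedness provides a path \<open>\<gamma>\<^sub>g\<close> from \<open>1\<close> to every \<open>g\<close>. The loop
  \<open>\<gamma>\<^sub>h + \<gamma>\<^sub>g h - \<gamma>\<^sub>g\<^sub>h\<close> is a 2-cocycle of \<open>G\<close> with values in \<open>H\<^sub>2(Q)\<close>, as translations act trivially there,
  and on \<open>H\<^sub>2(G)\<close> it does not depend on the choice of the paths. Since \<open>\<phi>\<close> carries paths to paths and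
  acts trivially on \<open>H\<^sub>2(Q)\<close>, the cocycle induces a map \<open>H\<^sub>2(G)\<^sub>\<phi> \<rightarrow> H\<^sub>2(Q)\<close> (\<open>loop_boundary\<close>, \<open>loop_phi\<close>).

  From \<open>Q\<close> to \<open>G\<close>: view \<open>[a b\<^sup>-\<^sup>1 | b c\<^sup>-\<^sup>1]\<close> as the simplex \<open>\<langle>a, b, c\<rangle>\<close> with vertices in \<open>G\<close>, taken up to
  right translation, and send the edge \<open>(x, y)\<close> to \<open>\<langle>y, x, 1\<rangle> - \<langle>y, x \<star> y, 1\<rangle>\<close>. The boundary of this
  chain is \<open>[x] - [x \<star> y] + (1 - \<phi>) [y x\<^sup>-\<^sup>1]\<close>. For a cycle \<open>c\<close> of \<open>Q\<close> the first two terms cancel, so the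
  1-chain \<open>e\<close> that collects the \<open>[y x\<^sup>-\<^sup>1]\<close> has a class in \<open>H\<^sub>1(G) = G\<^sub>a\<^sub>b\<close> killed by \<open>1 - \<phi>\<close>. This
  is where the hypothesis on \<open>G\<^sub>a\<^sub>b\<close> enters: \<open>e\<close> is the boundary of some \<open>v\<close>, and the image of \<open>c\<close>
  corrected by \<open>(1 - \<phi>) v\<close> is a 2-cycle of \<open>G\<close>, well defined up to \<open>(1 - \<phi>) Z\<^sub>2(G)\<close>.

  The two maps are inverse to each other by the congruences \<open>loop_prism\<close> and \<open>prism_loop\<close>. The
  choice of \<open>v\<close> is avoided by stating the result as follows: the loop map sends the cycles of \<open>G\<close> onto
  the cycles of \<open>Q\<close> modulo boundaries (\<open>loop_surjective\<close>), and a cycle of \<open>G\<close> goes to a boundary iff it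
  lies in \<open>B\<^sub>2(G) + (1 - \<phi>) Z\<^sub>2(G)\<close> (\<open>loop_kernel\<close>). So \<open>Z\<^sub>2(G)\<close> maps onto \<open>H\<^sub>2(Q)\<close> and onto \<open>H\<^sub>2(G)\<^sub>\<phi>\<close>
  with the same kernel.\<close>

section \<open>Subgroups of free abelian groups and congruences\<close>

text \<open>The chain groups are subgroups of the additive group of a type. Statements about classes of
  chains are therefore phrased as membership of a difference in such a subgroup, without passing to
  quotients.\<close>

definition additive_group :: "'a::ab_group_add set \<Rightarrow> bool"
  where "additive_group B \<longleftrightarrow> 0 \<in> B \<and> (\<forall>a\<in>B. \<forall>b\<in>B. a - b \<in> B)"

lemma additive_groupD:
  assumes "additive_group B"
  shows additive_group_zero: "0 \<in> B"
    and additive_group_diff: "a \<in> B \<Longrightarrow> b \<in> B \<Longrightarrow> a - b \<in> B"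
    and additive_group_minus: "a \<in> B \<Longrightarrow> - a \<in> B"
    and additive_group_add: "a \<in> B \<Longrightarrow> b \<in> B \<Longrightarrow> a + b \<in> B"
proof -
  show 0: "0 \<in> B" and diff: "a \<in> B \<Longrightarrow> b \<in> B \<Longrightarrow> a - b \<in> B" for a b
    using assms by (auto simp: additive_group_def)
  show minus: "a \<in> B \<Longrightarrow> - a \<in> B" for a
    using diff [OF 0] by fastforce
  show "a \<in> B \<Longrightarrow> b \<in> B \<Longrightarrow> a + b \<in> B"
    using diff [OF _ minus] by fastforce
qed

lemma cong_trans: "additive_group B \<Longrightarrow> a - b \<in> B \<Longrightarrow> b - c \<in> B \<Longrightarrow> a - c \<in> B"
  using additive_group_add [of B "a - b" "b - c"] by simp

lemma cong_sym: "additive_group B \<Longrightarrow> a - b \<in> B \<Longrightarrow> b - a \<in> B"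
  using additive_group_minus [of B "a - b"] by simp

definition tuples :: "'a set \<Rightarrow> nat \<Rightarrow> 'a list set"
  where "tuples S n = {xs. length xs = n \<and> set xs \<subseteq> S}"

lemma mem_tuples [simp]:
  "xs \<in> tuples S n \<longleftrightarrow> length xs = n \<and> set xs \<subseteq> S"
  by (simp add: tuples_def)

definition chains_on :: "'b set \<Rightarrow> ('b \<Rightarrow>\<^sub>0 int) set"
  where "chains_on T = {c. Poly_Mapping.keys c \<subseteq> T}"

lemma chains_free_Abelian_group: "chains_on T = carrier (free_Abelian_group T)"
  by (auto simp: chains_on_def)

lemma carrier_tuple_chains: "carrier (tuple_chains S n) = chains_on (tuples S n)"
  by (simp add: tuple_chains_def tuples_def chains_free_Abelian_group)

lemma additive_group_chains: "additive_group (chains_on T)"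
  by (auto simp: additive_group_def chains_on_def dest!: subsetD [OF keys_diff])

lemmas chains_on_zero [simp] = additive_group_zero [OF additive_group_chains]
  and chains_on_diff [intro, simp] = additive_group_diff [OF additive_group_chains]
  and chains_on_minus [intro, simp] = additive_group_minus [OF additive_group_chains]
  and chains_on_add [intro, simp] = additive_group_add [OF additive_group_chains]

lemma frag_of_in_chains [simp]: "frag_of x \<in> chains_on T \<longleftrightarrow> x \<in> T"
  by (simp add: chains_on_def)

text \<open>The induction principle behind all chain-level congruences: it suffices to check them on basis
  elements. Taking for \<open>L\<close> a difference of two additive maps shows that these agree modulo \<open>B\<close>.\<close>

lemma additive_map_in:
  assumes c: "c \<in> chains_on T" and B: "additive_group B"
    and L: "\<And>a b. L (a - b) = L a - L b"
    and gen: "\<And>x. x \<in> T \<Longrightarrow> L (frag_of x) \<in> B"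
  shows "L c \<in> B"
proof -
  have "Poly_Mapping.keys c \<subseteq> T"
    using c by (simp add: chains_on_def)
  then show ?thesis
  proof (induction rule: frag_induction)
    case zero
    show ?case
      using L [of 0 0] additive_group_zero [OF B] by simp
  next
    case (diff a b)
    then show ?case
      by (simp add: L additive_group_diff [OF B])
  qed (use gen in auto)
qed

lemma additive_group_singleton_zero: "additive_group {0}"
  by (simp add: additive_group_def)

lemma additive_map_eq:
  fixes L M :: "_ \<Rightarrow> 'b::ab_group_add"
  assumes "c \<in> chains_on T"
    and "\<And>a b. L (a - b) = L a - L b" "\<And>a b. M (a - b) = M a - M b"
    and "\<And>x. x \<in> T \<Longrightarrow> L (frag_of x) = M (frag_of x)"
  shows "L c = M c"
  using additive_map_in [of c T "{0}" "\<lambda>c. L c - M c"] assms additive_group_singleton_zero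
  by (simp add: algebra_simps)

lemma frag_extend_in_chains:
  assumes "c \<in> chains_on T" "\<And>x. x \<in> T \<Longrightarrow> f x \<in> chains_on U"
  shows "frag_extend f c \<in> chains_on U"
  by (rule additive_map_in [OF assms(1) additive_group_chains])
    (simp_all add: frag_extend_diff assms(2))

lemma tuple1E:
  assumes "xs \<in> tuples S 1" obtains x where "x \<in> S" "xs = [x]"
  using assms by (auto simp: length_Suc_conv)

lemma tuple2E:
  assumes "xs \<in> tuples S 2" obtains x y where "x \<in> S" "y \<in> S" "xs = [x, y]"
  using assms by (auto simp: length_Suc_conv numeral_2_eq_2)

lemma tuple3E:
  assumes "xs \<in> tuples S 3"
  obtains x y z where "x \<in> S" "y \<in> S" "z \<in> S" "xs = [x, y, z]"
  using assms by (auto simp: length_Suc_conv numeral_3_eq_3)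

abbreviation push :: "('a \<Rightarrow> 'a) \<Rightarrow> ('a list \<Rightarrow>\<^sub>0 int) \<Rightarrow> ('a list \<Rightarrow>\<^sub>0 int)"
  where "push f \<equiv> frag_extend (\<lambda>xs. frag_of (map f xs))"

lemma push_in_chains:
  assumes "c \<in> chains_on (tuples S n)" "\<And>x. x \<in> S \<Longrightarrow> f x \<in> T"
  shows "push f c \<in> chains_on (tuples T n)"
  using assms by (intro frag_extend_in_chains [OF assms(1)]) auto

lemma push_push: "push f (push g c) = push (f \<circ> g) c"
  by (rule additive_map_eq [of c UNIV]) (auto simp: chains_on_def frag_extend_diff comp_def)

lemma push_cong:
  assumes "c \<in> chains_on (tuples S n)" "\<And>x. x \<in> S \<Longrightarrow> f x = g x"
  shows "push f c = push g c"
  by (rule additive_map_eq [OF assms(1)])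
    (use assms(2) in \<open>auto simp: frag_extend_diff frag_of_eq\<close>)

lemma push_ident:
  assumes "c \<in> chains_on (tuples S n)" "\<And>x. x \<in> S \<Longrightarrow> f x = x"
  shows "push f c = c"
  by (rule additive_map_eq [OF assms(1)])
    (use assms(2) in \<open>auto simp: frag_extend_diff frag_of_eq intro!: map_idI\<close>)

lemma rack_boundary_2:
  "rack_boundary_tuple Q [x, y] = frag_of [x] - frag_of [x \<triangleright>\<^bsub>Q\<^esub> y]"
  by (simp add: rack_boundary_tuple_def lessThan_Suc numeral_2_eq_2)

lemma rack_boundary_3:
  "rack_boundary_tuple Q [x, y, z] =
     frag_of [x, z] - frag_of [x \<triangleright>\<^bsub>Q\<^esub> y, z] - frag_of [x, y] + frag_of [x \<triangleright>\<^bsub>Q\<^esub> z, y \<triangleright>\<^bsub>Q\<^esub> z]"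
  by (simp add: rack_boundary_tuple_def lessThan_Suc numeral_3_eq_3)

lemma bar_boundary_2:
  "bar_boundary_tuple G [g, h] = frag_of [h] - frag_of [g \<otimes>\<^bsub>G\<^esub> h] + frag_of [g]"
  by (simp add: bar_boundary_tuple_def lessThan_Suc)

lemma bar_boundary_3:
  "bar_boundary_tuple G [g, h, k] =
     frag_of [h, k] - frag_of [g \<otimes>\<^bsub>G\<^esub> h, k] + frag_of [g, h \<otimes>\<^bsub>G\<^esub> k] - frag_of [g, h]"
  by (simp add: bar_boundary_tuple_def lessThan_Suc)

section \<open>Chains of a group and its first homology\<close>

context group
begin

abbreviation "C n \<equiv> chains_on (tuples (carrier G) n)"
abbreviation "dG \<equiv> frag_extend (bar_boundary_tuple G)"

definition BG :: "('a list \<Rightarrow>\<^sub>0 int) set" where "BG = dG ` C 3"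

lemma additive_BG: "additive_group BG"
  unfolding additive_group_def
proof (intro conjI ballI)
  show "0 \<in> BG"
    unfolding BG_def by (rule image_eqI [of _ _ 0]) simp_all
  fix c c' assume "c \<in> BG" "c' \<in> BG"
  then obtain t t' where "t \<in> C 3" "c = dG t" "t' \<in> C 3" "c' = dG t'"
    unfolding BG_def by (elim imageE)
  then show "c - c' \<in> BG"
    unfolding BG_def by (intro image_eqI [of _ _ "t - t'"]) (simp_all add: frag_extend_diff)
qed

lemmas BG_add = additive_group_add [OF additive_BG]
  and BG_diff = additive_group_diff [OF additive_BG]
  and BG_minus = additive_group_minus [OF additive_BG]
  and BG_zero = additive_group_zero [OF additive_BG]

lemma dG_in_BG:
  "g \<in> carrier G \<Longrightarrow> h \<in> carrier G \<Longrightarrow> k \<in> carrier G \<Longrightarrow> bar_boundary_tuple G [g, h, k] \<in> BG"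
  unfolding BG_def by (rule image_eqI [of _ _ "frag_of [g, h, k]"]) simp_all

lemma dG_closed: "c \<in> C 2 \<Longrightarrow> dG c \<in> C 1"
  by (erule frag_extend_in_chains, erule tuple2E) (auto simp: bar_boundary_2)

lemma dG_closed3: "c \<in> C 3 \<Longrightarrow> dG c \<in> C 2"
  by (erule frag_extend_in_chains, erule tuple3E) (auto simp: bar_boundary_3)

lemma dG_dG:
  assumes "c \<in> C 3" shows "dG (dG c) = 0"
proof (rule additive_map_eq [OF assms, of "\<lambda>c. dG (dG c)" "\<lambda>_. 0"])
  fix xs assume "xs \<in> tuples (carrier G) 3"
  then show "dG (dG (frag_of xs)) = 0"
    by (elim tuple3E) (simp add: bar_boundary_3 bar_boundary_2 frag_extend_diff
        frag_extend_add m_assoc)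
qed (simp_all add: frag_extend_diff)

abbreviation rtrans :: "'a \<Rightarrow> ('a list \<Rightarrow>\<^sub>0 int) \<Rightarrow> ('a list \<Rightarrow>\<^sub>0 int)"
  where "rtrans h \<equiv> push (\<lambda>x. x \<otimes> h)"

lemma rtrans_rtrans:
  "c \<in> C n \<Longrightarrow> g \<in> carrier G \<Longrightarrow> h \<in> carrier G \<Longrightarrow> rtrans h (rtrans g c) = rtrans (g \<otimes> h) c"
  unfolding push_push by (rule push_cong) (auto simp: m_assoc)

lemma rtrans_one: "c \<in> C n \<Longrightarrow> rtrans \<one> c = c"
  by (rule push_ident) auto

lemma rtrans_closed: "c \<in> C n \<Longrightarrow> h \<in> carrier G \<Longrightarrow> rtrans h c \<in> C n"
  by (rule push_in_chains) auto

lemma inv_mult_cancel_right: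
  "a \<in> carrier G \<Longrightarrow> b \<in> carrier G \<Longrightarrow> c \<in> carrier G \<Longrightarrow> (a \<otimes> b) \<otimes> inv (c \<otimes> b) = a \<otimes> inv c"
  by (simp add: inv_mult_group m_assoc) (metis inv_closed l_one m_assoc r_inv)

lemma mult_inv_mult: "x \<in> carrier G \<Longrightarrow> y \<in> carrier G \<Longrightarrow> y \<otimes> inv x \<otimes> x = y"
  by (simp add: m_assoc)

abbreviation "BG1 \<equiv> dG ` C 2"

lemma additive_BG1: "additive_group BG1"
  unfolding additive_group_def
proof (intro conjI ballI)
  show "0 \<in> BG1"
    by (rule image_eqI [of _ _ 0]) simp_all
  fix c c' assume "c \<in> BG1" "c' \<in> BG1"
  then obtain t t' where "t \<in> C 2" "c = dG t" "t' \<in> C 2" "c' = dG t'"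
    by (elim imageE)
  then show "c - c' \<in> BG1"
    by (intro image_eqI [of _ _ "t - t'"]) (simp_all add: frag_extend_diff)
qed

lemma mult_class:
  "g \<in> carrier G \<Longrightarrow> h \<in> carrier G \<Longrightarrow> frag_of [g] + frag_of [h] - frag_of [g \<otimes> h] \<in> BG1"
  by (rule image_eqI [of _ _ "frag_of [g, h]"]) (simp_all add: bar_boundary_2)

lemma one_class: "frag_of [\<one>] \<in> BG1"
  using mult_class [of \<one> \<one>] by simp

lemma inv_class: "g \<in> carrier G \<Longrightarrow> frag_of [g] + frag_of [inv g] \<in> BG1"
  using additive_group_add [OF additive_BG1 mult_class [of g "inv g"] one_class] by simp

lemma mult_in_BG1:
  assumes "g \<in> carrier G" "h \<in> carrier G" "frag_of [g] + frag_of [h] \<in> BG1"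
  shows "frag_of [g \<otimes> h] \<in> BG1"
  using additive_group_diff [OF additive_BG1 assms(3) mult_class [OF assms(1,2)]] by simp

text \<open>Modulo boundaries, \<open>[g h]\<close> and \<open>[h g]\<close> are both \<open>[g] + [h]\<close>, and the commutator is the product of
  \<open>g h\<close> and the inverse of \<open>h g\<close>.\<close>

lemma commutator_in_BG1:
  assumes gh: "g \<in> carrier G" "h \<in> carrier G"
  shows "frag_of [g \<otimes> h \<otimes> inv g \<otimes> inv h] \<in> BG1"
proof -
  have "frag_of [g \<otimes> h] + frag_of [inv (h \<otimes> g)] =
      (frag_of [h] + frag_of [g] - frag_of [h \<otimes> g]) - (frag_of [g] + frag_of [h] - frag_of [g \<otimes> h])
      + (frag_of [h \<otimes> g] + frag_of [inv (h \<otimes> g)])"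
    by simp
  also have "\<dots> \<in> BG1"
    using gh
    by (intro additive_group_add [OF additive_BG1] additive_group_diff [OF additive_BG1]
        mult_class inv_class) auto
  finally have "frag_of [(g \<otimes> h) \<otimes> inv (h \<otimes> g)] \<in> BG1"
    using gh by (intro mult_in_BG1) auto
  then show ?thesis
    using gh by (simp add: inv_mult_group m_assoc)
qed

lemma derived_in_BG1:
  assumes "g \<in> derived G (carrier G)" shows "frag_of [g] \<in> BG1"
proof -
  define S where "S = {g \<in> carrier G. frag_of [g] \<in> BG1}"
  have "subgroup S G"
  proof
    fix g h assume "g \<in> S" "h \<in> S"
    then show "g \<otimes> h \<in> S"
      using additive_group_add [OF additive_BG1] by (auto simp: S_def intro: mult_in_BG1)
  next
    fix g assume "g \<in> S"
    then show "inv g \<in> S"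
      using additive_group_diff [OF additive_BG1 inv_class [of g], of "frag_of [g]"]
      by (auto simp: S_def)
  qed (use one_class in \<open>auto simp: S_def\<close>)
  moreover have "derived_set G (carrier G) \<subseteq> S"
    using commutator_in_BG1 by (auto simp: S_def)
  ultimately have "derived G (carrier G) \<subseteq> S"
    unfolding derived_def by (intro generate_subgroup_incl)
  with assms show ?thesis
    by (auto simp: S_def)
qed

text \<open>The converse uses the homomorphism from the 1-chains to the abelianization that sends \<open>[g]\<close> to
  the class of \<open>g\<close>. It kills \<open>\<partial>[g|h] = [h] - [g h] + [g]\<close>, and so it detects that \<open>g\<close> is a product of
  commutators.\<close>

lemma BG1_in_derived:
  assumes g: "g \<in> carrier G" and bnd: "frag_of [g] \<in> BG1"
  shows "g \<in> derived G (carrier G)"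
proof -
  let ?D = "derived G (carrier G)"
  interpret D: normal ?D G
    by (rule derived_self_is_normal)
  interpret A: comm_group "G Mod ?D"
    by (rule derived_quot_is_comm_group)
  have coset: "?D #> x \<in> carrier (G Mod ?D)" if "x \<in> carrier G" for x
    using that by (simp add: carrier_FactGroup)
  obtain F where F: "F \<in> hom (free_Abelian_group (tuples (carrier G) 1)) (G Mod ?D)"
    "\<And>xs. xs \<in> tuples (carrier G) 1 \<Longrightarrow> F (frag_of xs) = ?D #> hd xs"
  proof (rule A.free_Abelian_group_universal [of "\<lambda>xs. ?D #> hd xs" "tuples (carrier G) 1"])
    show "(\<lambda>xs. ?D #> hd xs) ` tuples (carrier G) 1 \<subseteq> carrier (G Mod ?D)"
      using coset by (auto elim!: tuple1E simp del: One_nat_def)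
  qed blast
  interpret F: group_hom "free_Abelian_group (tuples (carrier G) 1)" "G Mod ?D" F
    using F(1) A.group_axioms by (simp add: group_hom_def group_hom_axioms_def)
  have F_diff: "F (c - c') = F c \<otimes>\<^bsub>G Mod ?D\<^esub> inv\<^bsub>G Mod ?D\<^esub> F c'" if "c \<in> C 1" "c' \<in> C 1" for c c'
  proof -
    have "c' \<in> carrier (free_Abelian_group (tuples (carrier G) 1))"
      "- c' \<in> carrier (free_Abelian_group (tuples (carrier G) 1))"
      "c \<in> carrier (free_Abelian_group (tuples (carrier G) 1))"
      using that by (simp_all add: chains_on_def)
    then show ?thesis
      using F.hom_mult [of c "- c'"] F.hom_inv [of c'] by simp
  qed
  have gen: "F (dG (frag_of xs)) = \<one>\<^bsub>G Mod ?D\<^esub>" if xs: "xs \<in> tuples (carrier G) 2" for xs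
  proof -
    obtain x y where xy: "x \<in> carrier G" "y \<in> carrier G" "xs = [x, y]"
      by (rule tuple2E [OF xs])
    have "F (dG (frag_of xs)) = F (frag_of [x] - (frag_of [x \<otimes> y] - frag_of [y]))"
      by (simp add: xy(3) bar_boundary_2 algebra_simps)
    also have "\<dots> = (?D #> x) \<otimes>\<^bsub>G Mod ?D\<^esub>
        inv\<^bsub>G Mod ?D\<^esub> ((?D #> (x \<otimes> y)) \<otimes>\<^bsub>G Mod ?D\<^esub> inv\<^bsub>G Mod ?D\<^esub> (?D #> y))"
      using xy by (simp add: F_diff F(2))
    also have "?D #> (x \<otimes> y) = (?D #> x) \<otimes>\<^bsub>G Mod ?D\<^esub> (?D #> y)"
      using xy D.rcos_sum by simp
    also have "(?D #> x) \<otimes>\<^bsub>G Mod ?D\<^esub> inv\<^bsub>G Mod ?D\<^esub>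
        ((?D #> x) \<otimes>\<^bsub>G Mod ?D\<^esub> (?D #> y) \<otimes>\<^bsub>G Mod ?D\<^esub> inv\<^bsub>G Mod ?D\<^esub> (?D #> y)) = \<one>\<^bsub>G Mod ?D\<^esub>"
      using coset [OF xy(1)] coset [OF xy(2)]
      by (simp only: A.m_assoc A.r_inv A.r_one A.inv_closed)
    finally show ?thesis .
  qed
  have "F (dG u) = \<one>\<^bsub>G Mod ?D\<^esub>" if "u \<in> C 2" for u
  proof -
    have "Poly_Mapping.keys u \<subseteq> tuples (carrier G) 2"
      using that by (simp add: chains_on_def)
    then show ?thesis
    proof (rule free_Abelian_group_induct)
      show "F (dG 0) = \<one>\<^bsub>G Mod ?D\<^esub>"
        using F.hom_one by simp
    next
      fix u v
      assume "Poly_Mapping.keys u \<subseteq> tuples (carrier G) 2" "Poly_Mapping.keys v \<subseteq> tuples (carrier G) 2"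
        and *: "F (dG u) = \<one>\<^bsub>G Mod ?D\<^esub>" "F (dG v) = \<one>\<^bsub>G Mod ?D\<^esub>"
      then have "dG u \<in> C 1" "dG v \<in> C 1"
        using dG_closed [of u] dG_closed [of v] by (simp_all add: chains_on_def)
      then have "F (dG (u - v)) = F (dG u) \<otimes>\<^bsub>G Mod ?D\<^esub> inv\<^bsub>G Mod ?D\<^esub> F (dG v)"
        by (simp only: frag_extend_diff F_diff)
      also have "\<dots> = \<one>\<^bsub>G Mod ?D\<^esub>"
        unfolding * by (simp only: A.inv_one A.r_one A.one_closed)
      finally show "F (dG (u - v)) = \<one>\<^bsub>G Mod ?D\<^esub>" .
    qed (rule gen)
  qed
  then have "?D #> g = ?D"
    using bnd g F(2) [of "[g]"] by auto
  then show ?thesis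
    by (rule coset_join1 [OF _ g D.subgroup_axioms])
qed

lemma C1_class:
  assumes "c \<in> C 1"
  shows "\<exists>g \<in> carrier G. c - frag_of [g] \<in> BG1"
proof -
  define K where "K = {c. \<exists>g \<in> carrier G. c - frag_of [g] \<in> BG1}"
  have "additive_group K"
    unfolding additive_group_def
  proof (intro conjI ballI)
    show "0 \<in> K"
      unfolding K_def using additive_group_minus [OF additive_BG1 one_class]
      by (intro CollectI bexI [of _ \<one>]) simp_all
    fix c c' assume "c \<in> K" "c' \<in> K"
    then obtain g h where gh: "g \<in> carrier G" "h \<in> carrier G"
      "c - frag_of [g] \<in> BG1" "c' - frag_of [h] \<in> BG1"
      unfolding K_def by blast
    have "c - c' - frag_of [g \<otimes> inv h] = (c - frag_of [g]) - (c' - frag_of [h])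
        + (frag_of [g] + frag_of [inv h] - frag_of [g \<otimes> inv h]) - (frag_of [h] + frag_of [inv h])"
      by simp
    also have "\<dots> \<in> BG1"
      by (rule additive_group_diff [OF additive_BG1 additive_group_add [OF additive_BG1
          additive_group_diff [OF additive_BG1 gh(3,4)] mult_class] inv_class]) (use gh in auto)
    finally show "c - c' \<in> K"
      unfolding K_def using gh by (intro CollectI bexI [of _ "g \<otimes> inv h"]) auto
  qed
  then have "c \<in> K"
  proof (rule additive_map_in [OF assms, of _ "\<lambda>c. c"])
    fix xs assume "xs \<in> tuples (carrier G) 1"
    then show "frag_of xs \<in> K"
      unfolding K_def using additive_group_zero [OF additive_BG1]
      by (elim tuple1E) (intro CollectI, rule bexI, simp_all)
  qed auto
  then show ?thesis
    by (simp add: K_def)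
qed

end

section \<open>The generalized Alexander quandle\<close>

locale group_automorphism = group G for G (structure) +
  fixes \<phi> :: "'a \<Rightarrow> 'a"
  assumes phi_iso: "\<phi> \<in> iso G G"
begin

sublocale phi: group_hom G G \<phi>
  using phi_iso by unfold_locales (auto simp: iso_def)

definition star :: "'a \<Rightarrow> 'a \<Rightarrow> 'a"  (infixl \<open>\<star>\<close> 70)
  where "x \<star> y = \<phi> (x \<otimes> inv y) \<otimes> y"

abbreviation "dQ \<equiv> frag_extend (rack_boundary_tuple (gen_Alexander G \<phi>))"

lemma qop_gen_Alexander [simp]: "x \<triangleright>\<^bsub>gen_Alexander G \<phi>\<^esub> y = x \<star> y"
  by (simp add: gen_Alexander_def star_def)

lemma carrier_gen_Alexander [simp]: "carrier (gen_Alexander G \<phi>) = carrier G"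
  by (simp add: gen_Alexander_def)

sublocale Q: quandle "gen_Alexander G \<phi>"
  by (rule quandle_gen_Alexander [OF group_axioms phi_iso])

lemma star_closed [simp]: "x \<in> carrier G \<Longrightarrow> y \<in> carrier G \<Longrightarrow> x \<star> y \<in> carrier G"
  by (simp add: star_def)

lemma star_idem [simp]: "x \<in> carrier G \<Longrightarrow> x \<star> x = x"
  by (simp add: star_def)

lemma star_distrib:
  "x \<in> carrier G \<Longrightarrow> y \<in> carrier G \<Longrightarrow> z \<in> carrier G \<Longrightarrow> (x \<star> y) \<star> z = (x \<star> z) \<star> (y \<star> z)"
  using Q.right_distrib [of x y z] by simp

lemma star_one: "x \<in> carrier G \<Longrightarrow> x \<star> \<one> = \<phi> x"
  by (simp add: star_def)

lemma star_eq: "x \<in> carrier G \<Longrightarrow> y \<in> carrier G \<Longrightarrow> x \<star> y = \<phi> x \<otimes> (inv (\<phi> y) \<otimes> y)"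
  by (simp add: star_def m_assoc)

lemma star_mult:
  "x \<in> carrier G \<Longrightarrow> y \<in> carrier G \<Longrightarrow> h \<in> carrier G \<Longrightarrow> (x \<otimes> h) \<star> (y \<otimes> h) = (x \<star> y) \<otimes> h"
  by (simp only: star_def m_closed inv_mult_cancel_right) (simp add: m_assoc)

lemma phi_star: "x \<in> carrier G \<Longrightarrow> y \<in> carrier G \<Longrightarrow> \<phi> (x \<star> y) = \<phi> x \<star> \<phi> y"
  by (simp add: star_def)

text \<open>Used for the vertices \<open>p\<close> of a path from \<open>1\<close>: the map \<open>_ \<star> y\<close> turns a translate of the path
  into a translate of its image under \<open>\<phi>\<close>.\<close>

lemma mult_star:
  "p \<in> carrier G \<Longrightarrow> x \<in> carrier G \<Longrightarrow> y \<in> carrier G \<Longrightarrow> (p \<otimes> x) \<star> y = \<phi> p \<otimes> (x \<star> y)"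
  by (simp add: star_def m_assoc)

lemma mult_inv_star: "x \<in> carrier G \<Longrightarrow> y \<in> carrier G \<Longrightarrow> y \<otimes> inv (x \<star> y) = \<phi> (y \<otimes> inv x)"
  by (simp add: star_def inv_mult_group m_assoc [symmetric])

lemma phi_mult_star: "x \<in> carrier G \<Longrightarrow> y \<in> carrier G \<Longrightarrow> \<phi> (y \<otimes> inv x) \<otimes> (x \<star> y) = y"
  using mult_inv_mult [of "x \<star> y" y] mult_inv_star [of x y] by simp

lemma star_mult_inv_star:
  "x \<in> carrier G \<Longrightarrow> y \<in> carrier G \<Longrightarrow> z \<in> carrier G \<Longrightarrow> (y \<star> z) \<otimes> inv (x \<star> z) = \<phi> (y \<otimes> inv x)"
  by (simp add: star_eq inv_mult_cancel_right)

definition diag :: "'a list set" where "diag = (\<lambda>x. [x, x]) ` carrier G"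

text \<open>The cycles of degree 2 that vanish in \<open>H\<^sub>2(Q)\<close>.\<close>

definition BQ :: "('a list \<Rightarrow>\<^sub>0 int) set"
  where "BQ = {dQ t + e | t e. t \<in> C 3 \<and> e \<in> chains_on diag}"

lemma BQ_I: "t \<in> C 3 \<Longrightarrow> e \<in> chains_on diag \<Longrightarrow> dQ t + e \<in> BQ"
  unfolding BQ_def by (intro CollectI exI [of _ t] exI [of _ e]) simp

lemma BQ_E:
  assumes "c \<in> BQ"
  obtains t e where "t \<in> C 3" "e \<in> chains_on diag" "c = dQ t + e"
  using assms unfolding BQ_def by (elim CollectE exE conjE) (rule that)

lemma additive_BQ: "additive_group BQ"
  unfolding additive_group_def
proof (intro conjI ballI)
  show "0 \<in> BQ"
    using BQ_I [of 0 0] by simp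
  fix c c' assume "c \<in> BQ" "c' \<in> BQ"
  then show "c - c' \<in> BQ"
  proof (elim BQ_E)
    fix t e t' e'
    assume *: "t \<in> C 3" "e \<in> chains_on diag" "t' \<in> C 3" "e' \<in> chains_on diag"
      and "c = dQ t + e" "c' = dQ t' + e'"
    then have "c - c' = dQ (t - t') + (e - e')"
      by (simp add: frag_extend_diff)
    then show ?thesis
      using * by (simp add: BQ_I)
  qed
qed

lemmas BQ_add = additive_group_add [OF additive_BQ]
  and BQ_diff = additive_group_diff [OF additive_BQ]
  and BQ_zero = additive_group_zero [OF additive_BQ]

lemma dQ_in_BQ:
  "x \<in> carrier G \<Longrightarrow> y \<in> carrier G \<Longrightarrow> z \<in> carrier G \<Longrightarrow>
    frag_of [x, z] - frag_of [x \<star> y, z] - frag_of [x, y] + frag_of [x \<star> z, y \<star> z] \<in> BQ"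
  unfolding BQ_def
  by (intro CollectI exI [of _ "frag_of [x, y, z]"] exI [of _ 0]) (simp add: rack_boundary_3)

lemma diag_in_BQ: "x \<in> carrier G \<Longrightarrow> frag_of [x, x] \<in> BQ"
  unfolding BQ_def
  by (intro CollectI exI [of _ "frag_of [x, x]"] exI [of _ 0]) (simp add: diag_def)

lemma dQ_closed: "c \<in> C 2 \<Longrightarrow> dQ c \<in> C 1"
  by (erule frag_extend_in_chains, erule tuple2E) (auto simp: rack_boundary_2)

lemma dQ_closed3: "c \<in> C 3 \<Longrightarrow> dQ c \<in> C 2"
  by (erule frag_extend_in_chains, erule tuple3E) (auto simp: rack_boundary_3)

lemma dQ_dQ:
  assumes "c \<in> C 3" shows "dQ (dQ c) = 0"
proof (rule additive_map_eq [OF assms, of "\<lambda>c. dQ (dQ c)" "\<lambda>_. 0"])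
  fix xs assume "xs \<in> tuples (carrier G) 3"
  then show "dQ (dQ (frag_of xs)) = 0"
  proof (elim tuple3E)
    fix x y z assume "x \<in> carrier G" "y \<in> carrier G" "z \<in> carrier G" "xs = [x, y, z]"
    then show ?thesis
      by (simp add: rack_boundary_3 rack_boundary_2 frag_extend_diff frag_extend_add
          star_distrib [of x y z])
  qed
qed (simp_all add: frag_extend_diff)

lemma dQ_diag:
  assumes "e \<in> chains_on diag" shows "dQ e = 0"
  by (rule additive_map_eq [OF assms, of dQ "\<lambda>_. 0"])
    (auto simp: frag_extend_diff diag_def rack_boundary_2)

lemma diag_subset: "chains_on diag \<subseteq> C 2"
  by (auto simp: chains_on_def diag_def)

lemma BQ_cycle:
  assumes "c \<in> BQ" shows "c \<in> C 2" "dQ c = 0"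
proof -
  obtain t e where te: "t \<in> C 3" "e \<in> chains_on diag" "c = dQ t + e"
    using assms by (rule BQ_E)
  then show "c \<in> C 2"
    using diag_subset dQ_closed3 by blast
  show "dQ c = 0"
    using te by (simp only: frag_extend_add dQ_dQ dQ_diag) simp
qed

lemma dQ_push:
  assumes "c \<in> C 2" and "\<And>x. x \<in> carrier G \<Longrightarrow> f x \<in> carrier G"
    and "\<And>x y. x \<in> carrier G \<Longrightarrow> y \<in> carrier G \<Longrightarrow> f (x \<star> y) = f x \<star> f y"
  shows "dQ (push f c) = push f (dQ c)"
proof (rule additive_map_eq [OF assms(1), of "\<lambda>c. dQ (push f c)" "\<lambda>c. push f (dQ c)"])
  fix xs assume "xs \<in> tuples (carrier G) 2"
  then show "dQ (push f (frag_of xs)) = push f (dQ (frag_of xs))"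
    by (elim tuple2E) (simp add: rack_boundary_2 frag_extend_diff assms(3))
qed (simp_all add: frag_extend_diff)

lemma dQ_rtrans: "c \<in> C 2 \<Longrightarrow> h \<in> carrier G \<Longrightarrow> dQ (rtrans h c) = rtrans h (dQ c)"
  by (rule dQ_push) (auto simp: star_mult)

lemma dQ_phi: "c \<in> C 2 \<Longrightarrow> dQ (push \<phi> c) = push \<phi> (dQ c)"
  by (rule dQ_push) (auto simp: phi_star)

lemma push_phi_closed: "c \<in> C n \<Longrightarrow> push \<phi> c \<in> C n"
  by (rule push_in_chains) auto

lemma push_phi_rtrans:
  "c \<in> C n \<Longrightarrow> h \<in> carrier G \<Longrightarrow> push \<phi> (rtrans h c) = rtrans (\<phi> h) (push \<phi> c)"
  unfolding push_push by (rule push_cong) auto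

lemma dG_push_phi:
  assumes "u \<in> C 2" shows "dG (push \<phi> u) = push \<phi> (dG u)"
proof (rule additive_map_eq [OF assms, of "\<lambda>u. dG (push \<phi> u)" "\<lambda>u. push \<phi> (dG u)"])
  fix xs assume "xs \<in> tuples (carrier G) 2"
  then show "dG (push \<phi> (frag_of xs)) = push \<phi> (dG (frag_of xs))"
    by (elim tuple2E) (simp add: bar_boundary_2 frag_extend_diff frag_extend_add)
qed (simp_all add: frag_extend_diff)

lemma dG_push_phi3:
  assumes "u \<in> C 3" shows "dG (push \<phi> u) = push \<phi> (dG u)"
proof (rule additive_map_eq [OF assms, of "\<lambda>u. dG (push \<phi> u)" "\<lambda>u. push \<phi> (dG u)"])
  fix xs assume "xs \<in> tuples (carrier G) 3"
  then show "dG (push \<phi> (frag_of xs)) = push \<phi> (dG (frag_of xs))"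
    by (elim tuple3E) (simp add: bar_boundary_3 frag_extend_diff frag_extend_add)
qed (simp_all add: frag_extend_diff)

section \<open>Invertibility of the endomorphism on the abelianization\<close>

text \<open>Every 1-chain is homologous to a single \<open>[g]\<close>. If \<open>(1 - \<phi>) [g]\<close> is a boundary, then \<open>g \<phi>(g)\<^sup>-\<^sup>1\<close> lies
  in the commutator subgroup, and injectivity on the abelianization puts \<open>g\<close> there too.\<close>

lemma one_minus_injective_on_H1:
  assumes inj: "one_minus (abelianization G) (abelianization_map G \<phi>)
      \<in> iso (abelianization G) (abelianization G)"
    and c: "c \<in> C 1" "c - push \<phi> c \<in> BG1"
  shows "c \<in> BG1"
proof -
  let ?D = "derived G (carrier G)"
  let ?f = "one_minus (abelianization G) (abelianization_map G \<phi>)"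
  interpret D: normal ?D G
    by (rule derived_self_is_normal)
  interpret A: comm_group "abelianization G"
    unfolding abelianization_def by (rule derived_quot_is_comm_group)
  note add = additive_group_add [OF additive_BG1] and diff = additive_group_diff [OF additive_BG1]
  obtain g where g: "g \<in> carrier G" "c - frag_of [g] \<in> BG1"
    using C1_class [OF c(1)] by blast
  have push: "push \<phi> (c - frag_of [g]) \<in> BG1"
    using g(2)
  proof
    fix u assume "c - frag_of [g] = dG u" "u \<in> C 2"
    then show ?thesis
      by (intro image_eqI [of _ _ "push \<phi> u"]) (simp_all add: dG_push_phi push_in_chains)
  qed
  have "(c - push \<phi> c) - (c - frag_of [g]) + push \<phi> (c - frag_of [g])
      + (frag_of [\<phi> g] + frag_of [inv (\<phi> g)]) \<in> BG1"
    by (rule add [OF add [OF diff [OF c(2) g(2)] push] inv_class]) (use g in auto)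
  then have "frag_of [g] + frag_of [inv (\<phi> g)] \<in> BG1"
    by (simp add: frag_extend_diff)
  then have "g \<otimes> inv (\<phi> g) \<in> ?D"
    using g by (intro BG1_in_derived mult_in_BG1) auto
  then have D_g: "?D #> (g \<otimes> inv (\<phi> g)) = ?D"
    using g by (intro coset_join2 D.subgroup_axioms) auto
  have phi_D: "\<phi> ` ?D \<subseteq> ?D"
    using phi.derived_img [of "carrier G"] phi_iso by (simp add: iso_def bij_betw_def)
  have f: "?f (?D #> x) = ?D #> (x \<otimes> inv (\<phi> x))" if "x \<in> carrier G" for x
  proof -
    have "abelianization_map G \<phi> (?D #> x) = ?D #> \<phi> x"
      unfolding abelianization_map_def
      by (rule Mod_map_r_coset [OF group_axioms group_axioms D.subgroup_axioms D.subgroup_axioms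
            phi.homh phi_D that])
    moreover have "inv\<^bsub>G Mod ?D\<^esub> (?D #> \<phi> x) = ?D #> inv (\<phi> x)"
      using that by (subst D.inv_FactGroup) (simp_all add: carrier_FactGroup D.rcos_inv)
    ultimately show ?thesis
      using that by (simp add: one_minus_def abelianization_def D.rcos_sum)
  qed
  have D_one: "?D #> \<one> = ?D"
    using D.subset by (rule coset_mult_one)
  have eq: "?f (?D #> g) = ?f (?D #> \<one>)"
    using f [OF g(1)] f [OF one_closed] D_g D_one by simp
  have coset: "?D #> x \<in> carrier (abelianization G)" if "x \<in> carrier G" for x
    using that by (simp add: abelianization_def carrier_FactGroup)
  have "inj_on ?f (carrier (abelianization G))"
    using inj by (simp add: iso_def bij_betw_def)
  then have "?D #> g = ?D #> \<one>"
    using eq coset [OF g(1)] coset [OF one_closed] by (rule inj_onD)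
  then have "g \<in> ?D"
    unfolding D_one by (rule coset_join1 [OF _ g(1) D.subgroup_axioms])
  then have "(c - frag_of [g]) + frag_of [g] \<in> BG1"
    by (intro add [OF g(2)] derived_in_BG1)
  then show ?thesis
    by simp
qed

section \<open>Triviality of the action on quandle cycles\<close>

text \<open>The map sends a vertex \<open>x\<close> to the edge \<open>(x, z)\<close> in chains of the quandle, and to \<open>[x|z]\<close> in chains of
  the group.\<close>

definition attach_tuple :: "'a \<Rightarrow> 'a list \<Rightarrow> ('a list \<Rightarrow>\<^sub>0 int)"
  where "attach_tuple z xs = (case xs of [x] \<Rightarrow> frag_of [x, z] | _ \<Rightarrow> 0)"

abbreviation "attach z \<equiv> frag_extend (attach_tuple z)"

lemma attach_tuple [simp]: "attach_tuple z [x] = frag_of [x, z]"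
  by (simp add: attach_tuple_def)

text \<open>The boundary of a triple \<open>(x, y, z)\<close>, solved for the difference of \<open>(x \<star> z, y \<star> z)\<close> and \<open>(x, y)\<close>. The
  rest, \<open>(x \<star> y, z) - (x, z)\<close>, depends on the end points of the edge \<open>(x, y)\<close> only; for a cycle it
  vanishes.\<close>

lemma push_star_cong:
  assumes c: "c \<in> C 2" and z: "z \<in> carrier G"
  shows "push (\<lambda>x. x \<star> z) c - c + attach z (dQ c) \<in> BQ"
proof (rule additive_map_in [OF c additive_BQ])
  fix xs assume "xs \<in> tuples (carrier G) 2"
  then show "push (\<lambda>x. x \<star> z) (frag_of xs) - frag_of xs + attach z (dQ (frag_of xs)) \<in> BQ"
  proof (elim tuple2E)
    fix x y assume xy: "x \<in> carrier G" "y \<in> carrier G" "xs = [x, y]"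
    then show ?thesis
      using dQ_in_BQ [OF xy(1,2) z]
      by (simp add: rack_boundary_2 attach_tuple_def frag_extend_diff algebra_simps)
  qed
qed (simp add: frag_extend_diff algebra_simps)

lemma push_star_cycle:
  assumes "c \<in> C 2" "dQ c = 0" "z \<in> carrier G"
  shows "push (\<lambda>x. x \<star> z) c - c \<in> BQ"
  using push_star_cong [OF assms(1,3)] assms(2) by simp

text \<open>\<open>\<phi>\<close> is the map \<open>_ \<star> 1\<close>.\<close>

lemma phi_cycle:
  assumes "c \<in> C 2" "dQ c = 0"
  shows "push \<phi> c - c \<in> BQ"
  using push_star_cycle [OF assms one_closed] push_cong [OF assms(1), of "\<lambda>x. x \<star> \<one>" \<phi>]
  by (simp add: star_one)

lemma cycle_phi_preimage:
  assumes "c \<in> C 2" "dQ c = 0"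
  obtains c' where "c' \<in> C 2" "dQ c' = 0" "push \<phi> c' = c"
proof
  define \<psi> where "\<psi> = inv_into (carrier G) \<phi>"
  have bij: "bij_betw \<phi> (carrier G) (carrier G)"
    using phi_iso by (simp add: iso_def)
  then have closed: "\<psi> x \<in> carrier G" and phi_psi: "\<phi> (\<psi> x) = x" if "x \<in> carrier G" for x
    using that by (auto simp: \<psi>_def bij_betw_def inv_into_into f_inv_into_f)
  have psi_star: "\<psi> (x \<star> y) = \<psi> x \<star> \<psi> y" if "x \<in> carrier G" "y \<in> carrier G" for x y
    by (rule inj_onD [OF bij_betw_imp_inj_on [OF bij]])
      (use that in \<open>simp_all add: closed phi_psi phi_star\<close>)
  show "push \<psi> c \<in> C 2"
    using assms(1) closed by (rule push_in_chains)
  show "dQ (push \<psi> c) = 0"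
    using assms by (simp add: dQ_push closed psi_star)
  show "push \<phi> (push \<psi> c) = c"
    unfolding push_push using assms(1) by (rule push_ident) (simp add: phi_psi)
qed

end

locale connected_group_automorphism = group_automorphism +
  assumes connected: "connected_quandle (gen_Alexander G \<phi>)"
begin

text \<open>Connectedness as an induction principle, with orbits of the inner automorphism group replaced by
  sets that are closed under all \<open>_ \<star> z\<close> and their inverses.\<close>

lemma star_invariant_subset_eq_carrier:
  assumes "\<one> \<in> S" "S \<subseteq> carrier G"
    and inv: "\<And>x z. x \<in> carrier G \<Longrightarrow> z \<in> carrier G \<Longrightarrow> x \<star> z \<in> S \<longleftrightarrow> x \<in> S"
  shows "S = carrier G"
proof (rule equalityI [OF assms(2) subsetI])
  let ?B = "BijGroup (carrier G)"
  let ?P = "\<lambda>f. f \<in> Bij (carrier G) \<and> (\<forall>x \<in> carrier G. f x \<in> S \<longleftrightarrow> x \<in> S)"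
  have symm: "?P (symm (gen_Alexander G \<phi>) z)" if z: "z \<in> carrier G" for z
  proof -
    have "symm (gen_Alexander G \<phi>) z = (\<lambda>x \<in> carrier G. x \<star> z)"
      by (simp add: symm_def)
    moreover have "bij_betw (\<lambda>x. x \<star> z) (carrier G) (carrier G)"
      using Q.right_bij [of z] z by simp
    ultimately show ?thesis
      using z inv by (simp add: Bij_def)
  qed
  have inverse: "?P (inv\<^bsub>?B\<^esub> f)" if f: "?P f" for f
  proof -
    from f have bij: "bij_betw f (carrier G) (carrier G)"
      by (simp add: Bij_def)
    have "inv_into (carrier G) f x \<in> S \<longleftrightarrow> x \<in> S" if x: "x \<in> carrier G" for x
    proof -
      have "inv_into (carrier G) f x \<in> carrier G"
        using bij_betw_inv_into [OF bij] x by (rule bij_betwE [THEN bspec])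
      moreover have "f (inv_into (carrier G) f x) = x"
        using bij x by (rule bij_betw_inv_into_right)
      ultimately show ?thesis
        using f by metis
    qed
    moreover have "inv\<^bsub>?B\<^esub> f = (\<lambda>x \<in> carrier G. inv_into (carrier G) f x)"
      using f by (intro inv_BijGroup) simp
    moreover have "(\<lambda>x \<in> carrier G. inv_into (carrier G) f x) \<in> Bij (carrier G)"
      using f by (intro restrict_inv_into_Bij) simp
    ultimately show ?thesis
      by simp
  qed
  have gen: "?P f" if "f \<in> generate ?B (symm (gen_Alexander G \<phi>) ` carrier G)" for f
    using that
  proof (induction rule: generate.induct)
    case one
    show ?case
      using id_Bij [of "carrier G"] by (simp add: BijGroup_def restrict_def)
  next
    case (eng f g)
    then have "f \<otimes>\<^bsub>?B\<^esub> g = compose (carrier G) f g"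
      by (simp add: BijGroup_def)
    moreover have "compose (carrier G) f g \<in> Bij (carrier G)"
      using eng.IH by (intro compose_Bij) simp_all
    moreover have "g x \<in> carrier G" if "x \<in> carrier G" for x
      using eng.IH that Bij_imp_funcset [of g "carrier G"] by blast
    ultimately show ?case
      using eng.IH by (simp add: compose_def restrict_def)
  next
    case (incl f)
    then show ?case
      using symm by blast
  next
    case (inv f)
    then show ?case
      using symm inverse by blast
  qed
  interpret connected_quandle "gen_Alexander G \<phi>"
    by (rule connected)
  fix g assume g: "g \<in> carrier G"
  obtain f where "f \<in> carrier (Inn (gen_Alexander G \<phi>))" "f \<one> = g"
    using transitive [of \<one> g] g by (metis carrier_gen_Alexander one_closed)
  then have "?P f"
    by (intro gen) (simp add: Inn_def)
  with \<open>f \<one> = g\<close> \<open>\<one> \<in> S\<close> show "g \<in> S"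
    by (metis one_closed)
qed

text \<open>The elements of \<open>G\<close> whose translation acts trivially form a \<open>\<phi>\<close>-invariant subgroup. It contains
  all \<open>\<phi>(z)\<^sup>-\<^sup>1 z\<close>, because \<open>x \<star> z = \<phi>(x) (\<phi>(z)\<^sup>-\<^sup>1 z)\<close> and both \<open>_ \<star> z\<close> and \<open>\<phi>\<close> act trivially. For the same
  reason it is invariant under all \<open>_ \<star> z\<close>, and so it is all of \<open>G\<close>.\<close>

lemma rtrans_cycle:
  assumes c: "c \<in> C 2" "dQ c = 0" and h: "h \<in> carrier G"
  shows "rtrans h c - c \<in> BQ"
proof -
  define Z where "Z = {c \<in> C 2. dQ c = 0}"
  define S where "S = {h \<in> carrier G. \<forall>c \<in> Z. rtrans h c - c \<in> BQ}"
  have rtrans_Z: "rtrans h c \<in> Z" if "c \<in> Z" "h \<in> carrier G" for c h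
    using that by (simp add: Z_def dQ_rtrans rtrans_closed)
  have phi_Z: "push \<phi> c \<in> Z \<and> push \<phi> c - c \<in> BQ" if "c \<in> Z" for c
    using that by (simp add: Z_def dQ_phi push_phi_closed phi_cycle)
  have phi_onto: "\<exists>c' \<in> Z. push \<phi> c' = c" if "c \<in> Z" for c
    using that cycle_phi_preimage [of c] by (auto simp: Z_def)
  note trans = cong_trans [OF additive_BQ] and sym = cong_sym [OF additive_BQ]
  have one: "\<one> \<in> S"
    by (auto simp: S_def rtrans_one Z_def BQ_zero)
  have S_I: "h \<in> S" if "h \<in> carrier G" "\<And>c. c \<in> Z \<Longrightarrow> rtrans h c - c \<in> BQ" for h
    using that unfolding S_def by blast
  have S_D: "h \<in> carrier G" "c \<in> Z \<Longrightarrow> rtrans h c - c \<in> BQ" if "h \<in> S" for h c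
    using that unfolding S_def by blast+
  have Z_D: "c \<in> C 2" if "c \<in> Z" for c
    using that by (simp add: Z_def)
  have mult: "g \<otimes> h \<in> S" if g: "g \<in> S" and h: "h \<in> S" for g h
  proof (rule S_I)
    fix c assume c: "c \<in> Z"
    have "rtrans h (rtrans g c) - rtrans g c \<in> BQ" "rtrans g c - c \<in> BQ"
      using c g h by (auto intro: rtrans_Z S_D)
    then have "rtrans h (rtrans g c) - c \<in> BQ"
      by (rule trans)
    moreover have "rtrans h (rtrans g c) = rtrans (g \<otimes> h) c"
      using Z_D [OF c] S_D(1) [OF g] S_D(1) [OF h] by (rule rtrans_rtrans)
    ultimately show "rtrans (g \<otimes> h) c - c \<in> BQ"
      by simp
  qed (use that S_D in auto)
  have inverse: "inv h \<in> S" if h: "h \<in> S" for h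
  proof (rule S_I)
    fix c assume c: "c \<in> Z"
    have "rtrans h (rtrans (inv h) c) = rtrans (inv h \<otimes> h) c"
      using Z_D [OF c] S_D(1) [OF h] by (intro rtrans_rtrans) auto
    also have "\<dots> = c"
      using rtrans_one [OF Z_D [OF c]] S_D(1) [OF h] by simp
    finally have "rtrans h (rtrans (inv h) c) = c" .
    moreover have "rtrans h (rtrans (inv h) c) - rtrans (inv h) c \<in> BQ"
      using S_D(1) [OF h] by (intro S_D(2) [OF h] rtrans_Z [OF c]) simp
    ultimately have "c - rtrans (inv h) c \<in> BQ"
      by simp
    then show "rtrans (inv h) c - c \<in> BQ"
      by (rule sym)
  qed (use h S_D in auto)
  have phi: "\<phi> h \<in> S \<longleftrightarrow> h \<in> S" if h: "h \<in> carrier G" for h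
  proof -
    have iff: "rtrans (\<phi> h) (push \<phi> c) - push \<phi> c \<in> BQ \<longleftrightarrow> rtrans h c - c \<in> BQ" if c: "c \<in> Z" for c
    proof -
      have 1: "rtrans (\<phi> h) (push \<phi> c) - rtrans h c \<in> BQ"
        using phi_Z [OF rtrans_Z [OF c h]] push_phi_rtrans [OF Z_D [OF c] h] by simp
      have 2: "push \<phi> c - c \<in> BQ"
        using phi_Z [OF c] by blast
      show ?thesis
      proof
        assume "rtrans (\<phi> h) (push \<phi> c) - push \<phi> c \<in> BQ"
        with 2 have "rtrans (\<phi> h) (push \<phi> c) - c \<in> BQ"
          by (rule trans [rotated])
        with sym [OF 1] show "rtrans h c - c \<in> BQ"
          by (rule trans)
      next
        assume "rtrans h c - c \<in> BQ"
        with 1 have "rtrans (\<phi> h) (push \<phi> c) - c \<in> BQ"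
          by (rule trans)
        then show "rtrans (\<phi> h) (push \<phi> c) - push \<phi> c \<in> BQ"
          using sym [OF 2] by (rule trans)
      qed
    qed
    show ?thesis
    proof
      assume "\<phi> h \<in> S"
      then show "h \<in> S"
        using iff phi_Z h by (intro S_I) (auto dest: S_D)
    next
      assume "h \<in> S"
      show "\<phi> h \<in> S"
      proof (rule S_I)
        fix c assume "c \<in> Z"
        then obtain c' where "c' \<in> Z" "push \<phi> c' = c"
          using phi_onto by blast
        then show "rtrans (\<phi> h) c - c \<in> BQ"
          using iff S_D(2) [OF \<open>h \<in> S\<close>] by blast
      qed (use h in auto)
    qed
  qed
  have gens: "inv (\<phi> z) \<otimes> z \<in> S" if z: "z \<in> carrier G" for z
  proof (rule S_I)
    fix c assume "c \<in> Z"
    then obtain c' where c': "c' \<in> Z" "push \<phi> c' = c"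
      using phi_onto by blast
    have "push (\<lambda>x. x \<star> z) c' = rtrans (inv (\<phi> z) \<otimes> z) (push \<phi> c')"
      unfolding push_push
      by (rule push_cong [OF Z_D [OF c'(1)]]) (use z in \<open>auto simp: star_eq\<close>)
    moreover have "push (\<lambda>x. x \<star> z) c' - c' \<in> BQ"
      using c'(1) z by (simp add: Z_def push_star_cycle)
    ultimately have "rtrans (inv (\<phi> z) \<otimes> z) c - c' \<in> BQ"
      using c'(2) by simp
    moreover have "c' - c \<in> BQ"
      using phi_Z [OF c'(1)] c'(2) sym [of c c'] by simp
    ultimately show "rtrans (inv (\<phi> z) \<otimes> z) c - c \<in> BQ"
      by (rule trans)
  qed (use z in auto)
  have "x \<star> z \<in> S \<longleftrightarrow> x \<in> S" if xz: "x \<in> carrier G" "z \<in> carrier G" for x z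
  proof -
    have "x \<star> z \<in> S \<longleftrightarrow> \<phi> x \<in> S"
    proof
      assume "x \<star> z \<in> S"
      then have "(x \<star> z) \<otimes> inv (inv (\<phi> z) \<otimes> z) \<in> S"
        by (rule mult [OF _ inverse [OF gens [OF xz(2)]]])
      moreover have "(x \<star> z) \<otimes> inv (inv (\<phi> z) \<otimes> z) = \<phi> x"
        using xz by (simp add: star_eq m_assoc)
      ultimately show "\<phi> x \<in> S"
        by simp
    next
      assume "\<phi> x \<in> S"
      then show "x \<star> z \<in> S"
        using mult [OF _ gens [OF xz(2)]] xz by (simp add: star_eq)
    qed
    then show ?thesis
      using phi xz by simp
  qed
  then have "S = carrier G"
    by (intro star_invariant_subset_eq_carrier one) (auto simp: S_def)
  with c h show ?thesis
    by (auto simp: S_def Z_def)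
qed

section \<open>From group chains to quandle cycles\<close>

lemma path_exists:
  assumes "g \<in> carrier G"
  shows "\<exists>c \<in> C 2. dQ c = frag_of [\<one>] - frag_of [g]"
proof -
  define S where "S = {g \<in> carrier G. \<exists>c \<in> C 2. dQ c = frag_of [\<one>] - frag_of [g]}"
  have "\<one> \<in> S"
    unfolding S_def by (auto intro!: bexI [of _ 0])
  moreover have "x \<star> z \<in> S \<longleftrightarrow> x \<in> S" if xz: "x \<in> carrier G" "z \<in> carrier G" for x z
  proof
    assume "x \<star> z \<in> S"
    then obtain c where "c \<in> C 2" "dQ c = frag_of [\<one>] - frag_of [x \<star> z]"
      by (auto simp: S_def)
    with xz show "x \<in> S"
      by (auto simp: S_def frag_extend_diff rack_boundary_2 intro!: bexI [of _ "c - frag_of [x, z]"])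
  next
    assume "x \<in> S"
    then obtain c where "c \<in> C 2" "dQ c = frag_of [\<one>] - frag_of [x]"
      by (auto simp: S_def)
    with xz show "x \<star> z \<in> S"
      by (auto simp: S_def frag_extend_add rack_boundary_2 intro!: bexI [of _ "c + frag_of [x, z]"])
  qed
  ultimately have "S = carrier G"
    by (intro star_invariant_subset_eq_carrier) (auto simp: S_def)
  with assms show ?thesis
    by (auto simp: S_def)
qed

definition path :: "'a \<Rightarrow> ('a list \<Rightarrow>\<^sub>0 int)"
  where "path g = (SOME c. c \<in> C 2 \<and> dQ c = frag_of [\<one>] - frag_of [g])"

lemma path:
  assumes "g \<in> carrier G"
  shows path_closed: "path g \<in> C 2" and dQ_path: "dQ (path g) = frag_of [\<one>] - frag_of [g]"
  using someI_ex [of "\<lambda>c. c \<in> C 2 \<and> dQ c = frag_of [\<one>] - frag_of [g]"] path_exists [OF assms]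
  by (auto simp: path_def)

definition path_tuple :: "'a list \<Rightarrow> ('a list \<Rightarrow>\<^sub>0 int)"
  where "path_tuple xs = (case xs of [g] \<Rightarrow> path g | _ \<Rightarrow> 0)"

text \<open>The loop that runs from \<open>1\<close> to \<open>h\<close>, on to \<open>g h\<close> along the translated path, and back to \<open>1\<close>.\<close>

definition loop_tuple :: "'a list \<Rightarrow> ('a list \<Rightarrow>\<^sub>0 int)"
  where "loop_tuple xs =
    (case xs of [g, h] \<Rightarrow> path h + rtrans h (path g) - path (g \<otimes> h) | _ \<Rightarrow> 0)"

text \<open>Both \<open>\<phi>(\<gamma>\<^sub>g)\<close> and \<open>\<gamma>\<^bsub>\<phi>(g)\<^esub>\<close> lead from \<open>1\<close> to \<open>\<phi>(g)\<close>; the cycle by which they differ measures how far the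
  chosen paths are from being \<open>\<phi>\<close>-equivariant.\<close>

definition defect_tuple :: "'a list \<Rightarrow> ('a list \<Rightarrow>\<^sub>0 int)"
  where "defect_tuple xs = (case xs of [g] \<Rightarrow> push \<phi> (path g) - path (\<phi> g) | _ \<Rightarrow> 0)"

abbreviation "paths \<equiv> frag_extend path_tuple"
abbreviation "loop \<equiv> frag_extend loop_tuple"
abbreviation "defect \<equiv> frag_extend defect_tuple"

lemma loop_tuple [simp]: "loop_tuple [g, h] = path h + rtrans h (path g) - path (g \<otimes> h)"
  by (simp add: loop_tuple_def)

lemma path_tuple [simp]: "path_tuple [g] = path g"
  by (simp add: path_tuple_def)

lemma defect_tuple [simp]: "defect_tuple [g] = push \<phi> (path g) - path (\<phi> g)"
  by (simp add: defect_tuple_def)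

lemma loop_cycle:
  assumes "u \<in> C 2"
  shows loop_closed: "loop u \<in> C 2" and dQ_loop: "dQ (loop u) = 0"
proof -
  show "loop u \<in> C 2"
    by (rule frag_extend_in_chains [OF assms], erule tuple2E)
      (auto intro!: path_closed rtrans_closed)
  show "dQ (loop u) = 0"
  proof (rule additive_map_eq [OF assms, of "\<lambda>u. dQ (loop u)" "\<lambda>_. 0"])
    fix xs assume "xs \<in> tuples (carrier G) 2"
    then show "dQ (loop (frag_of xs)) = 0"
      by (elim tuple2E) (simp add: frag_extend_diff frag_extend_add dQ_rtrans dQ_path path_closed)
  qed (simp_all add: frag_extend_diff)
qed

lemma defect_cycle:
  assumes "g \<in> carrier G"
  shows "defect_tuple [g] \<in> C 2" "dQ (defect_tuple [g]) = 0"
  using assms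
  by (simp_all add: frag_extend_diff dQ_phi path_closed dQ_path push_phi_closed)

text \<open>The cocycle identity. In the alternating sum over the faces of \<open>[g|h|k]\<close> all paths cancel but those
  that form the loop of \<open>[g|h]\<close>, once translated by \<open>k\<close> and once not; these agree modulo boundaries.\<close>

lemma loop_boundary:
  assumes "u \<in> BG" shows "loop u \<in> BQ"
proof -
  have "loop (dG t) \<in> BQ" if "t \<in> C 3" for t
  proof (rule additive_map_in [OF that additive_BQ])
    fix xs assume "xs \<in> tuples (carrier G) 3"
    then show "loop (dG (frag_of xs)) \<in> BQ"
    proof (elim tuple3E)
      fix g h k assume ghk: "g \<in> carrier G" "h \<in> carrier G" "k \<in> carrier G" and xs: "xs = [g, h, k]"
      have "loop (dG (frag_of xs)) = rtrans k (loop (frag_of [g, h])) - loop (frag_of [g, h])"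
        using ghk
        by (simp add: xs bar_boundary_3 frag_extend_diff frag_extend_add m_assoc
            rtrans_rtrans [OF path_closed])
      also have "\<dots> \<in> BQ"
        using ghk by (intro rtrans_cycle loop_closed dQ_loop) auto
      finally show ?thesis .
    qed
  qed (simp add: frag_extend_diff)
  with assms show ?thesis
    by (auto simp: BG_def)
qed

text \<open>Applying \<open>\<phi>\<close> to the loop of \<open>u\<close> does not change its class, and replacing \<open>\<phi>(\<gamma>\<^sub>g)\<close> by \<open>\<gamma>\<^bsub>\<phi>(g)\<^esub>\<close> in the
  result changes it by the coboundary of the defect. For a cycle \<open>u\<close> the defect term is zero.\<close>

lemma loop_phi:
  assumes u: "u \<in> C 2"
  shows "loop u - loop (push \<phi> u) - defect (dG u) \<in> BQ"
proof -
  have 1: "push \<phi> (loop u) - loop (push \<phi> u) - defect (dG u) \<in> BQ"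
  proof (rule additive_map_in [OF u additive_BQ])
    fix xs assume "xs \<in> tuples (carrier G) 2"
    then show "push \<phi> (loop (frag_of xs)) - loop (push \<phi> (frag_of xs)) - defect (dG (frag_of xs))
        \<in> BQ"
    proof (elim tuple2E)
      fix g h assume gh: "g \<in> carrier G" "h \<in> carrier G" and xs: "xs = [g, h]"
      have "push \<phi> (loop (frag_of xs)) - loop (push \<phi> (frag_of xs)) - defect (dG (frag_of xs))
          = rtrans (\<phi> h) (defect_tuple [g]) - defect_tuple [g]"
        using gh push_phi_rtrans [OF path_closed [OF gh(1)] gh(2)]
        by (simp add: xs bar_boundary_2 frag_extend_diff frag_extend_add)
      also have "\<dots> \<in> BQ"
        using gh by (intro rtrans_cycle defect_cycle) auto
      finally show ?thesis .
    qed
  qed (simp add: frag_extend_diff)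
  have 2: "push \<phi> (loop u) - loop u \<in> BQ"
    using u by (intro phi_cycle loop_cycle)
  show ?thesis
    using BQ_diff [OF 1 2] by (simp add: algebra_simps)
qed

end

section \<open>From quandle chains to group chains\<close>

context group_automorphism
begin

text \<open>The 1-simplex \<open>\<langle>y, x\<rangle>\<close> with vertices in \<open>G\<close>, up to right translation.\<close>

definition edge_tuple :: "'a list \<Rightarrow> ('a list \<Rightarrow>\<^sub>0 int)"
  where "edge_tuple xs = (case xs of [x, y] \<Rightarrow> frag_of [y \<otimes> inv x] | _ \<Rightarrow> 0)"

text \<open>In terms of simplices \<open>\<langle>a, b, c\<rangle> = [a b\<^sup>-\<^sup>1 | b c\<^sup>-\<^sup>1]\<close> up to right translation, this is
  \<open>\<langle>y, x, 1\<rangle> - \<langle>y, x \<star> y, 1\<rangle>\<close>, as \<open>y (x \<star> y)\<^sup>-\<^sup>1 = \<phi>(y x\<^sup>-\<^sup>1)\<close>.\<close>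

definition prism_tuple :: "'a list \<Rightarrow> ('a list \<Rightarrow>\<^sub>0 int)"
  where "prism_tuple xs = (case xs of
      [x, y] \<Rightarrow> frag_of [y \<otimes> inv x, x] - frag_of [\<phi> (y \<otimes> inv x), x \<star> y] | _ \<Rightarrow> 0)"

abbreviation "edge \<equiv> frag_extend edge_tuple"
abbreviation "prism \<equiv> frag_extend prism_tuple"

lemma edge_tuple [simp]: "edge_tuple [x, y] = frag_of [y \<otimes> inv x]"
  by (simp add: edge_tuple_def)

lemma prism_tuple [simp]:
  "prism_tuple [x, y] = frag_of [y \<otimes> inv x, x] - frag_of [\<phi> (y \<otimes> inv x), x \<star> y]"
  by (simp add: prism_tuple_def)

lemma edge_closed: "c \<in> C 2 \<Longrightarrow> edge c \<in> C 1"
  by (erule frag_extend_in_chains, erule tuple2E) auto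

lemma prism_closed: "c \<in> C 2 \<Longrightarrow> prism c \<in> C 2"
  by (erule frag_extend_in_chains, erule tuple2E) auto

text \<open>The boundary of \<open>\<langle>y, x, 1\<rangle>\<close> is \<open>[x] - [y] + [y x\<^sup>-\<^sup>1]\<close>, and that of \<open>\<langle>y, x \<star> y, 1\<rangle>\<close> is
  \<open>[x \<star> y] - [y] + [\<phi>(y x\<^sup>-\<^sup>1)]\<close>.\<close>

lemma dG_prism:
  assumes "c \<in> C 2"
  shows "dG (prism c) = dQ c + edge c - push \<phi> (edge c)"
proof (rule additive_map_eq [OF assms, of "\<lambda>c. dG (prism c)" "\<lambda>c. dQ c + edge c - push \<phi> (edge c)"])
  fix xs assume "xs \<in> tuples (carrier G) 2"
  then show "dG (prism (frag_of xs)) = dQ (frag_of xs) + edge (frag_of xs) - push \<phi> (edge (frag_of xs))"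
  proof (elim tuple2E)
    fix x y assume "x \<in> carrier G" "y \<in> carrier G" "xs = [x, y]"
    then show ?thesis
      using phi_mult_star [of x y] mult_inv_mult [of x y]
      by (simp add: bar_boundary_2 rack_boundary_2 frag_extend_diff del: phi.hom_mult phi.hom_inv)
  qed
qed (simp_all add: frag_extend_diff)

text \<open>The cone \<open>\<langle>y, x, 1, h\<^sup>-\<^sup>1\<rangle> = [y x\<^sup>-\<^sup>1 | x | h]\<close> and its analogue for \<open>x \<star> y\<close> connect the images of an edge
  and of its translate; what remains depends on the end points of the edge only.\<close>

lemma prism_rtrans:
  assumes "c \<in> C 2" and h: "h \<in> carrier G"
  shows "prism (rtrans h c) - prism c + attach h (dQ c) \<in> BG"
proof (rule additive_map_in [OF assms(1) additive_BG])
  fix xs assume "xs \<in> tuples (carrier G) 2"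
  then show "prism (rtrans h (frag_of xs)) - prism (frag_of xs) + attach h (dQ (frag_of xs)) \<in> BG"
  proof (elim tuple2E)
    fix x y assume xy: "x \<in> carrier G" "y \<in> carrier G" and xs: "xs = [x, y]"
    define a where "a = y \<otimes> inv x"
    have a: "a \<in> carrier G" "a \<otimes> x = y" "\<phi> a \<otimes> (x \<star> y) = y"
      using xy mult_inv_mult phi_mult_star by (simp_all add: a_def del: phi.hom_mult phi.hom_inv)
    have "prism (rtrans h (frag_of xs)) - prism (frag_of xs) + attach h (dQ (frag_of xs))
      = bar_boundary_tuple G [a, x, h] - bar_boundary_tuple G [\<phi> a, x \<star> y, h]"
      using xy h
      by (simp add: xs frag_extend_diff rack_boundary_2 bar_boundary_3 a star_mult
          inv_mult_cancel_right flip: a_def)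
    also have "\<dots> \<in> BG"
      using a xy h by (intro BG_diff dG_in_BG) auto
    finally show ?thesis .
  qed
qed (simp add: frag_extend_diff)

lemma edge_rtrans:
  assumes "c \<in> C 2" and h: "h \<in> carrier G"
  shows "edge (rtrans h c) = edge c"
proof (rule additive_map_eq [OF assms(1), of "\<lambda>c. edge (rtrans h c)" edge])
  fix xs assume "xs \<in> tuples (carrier G) 2"
  then show "edge (rtrans h (frag_of xs)) = edge (frag_of xs)"
    using h by (elim tuple2E) (simp add: inv_mult_cancel_right)
qed (simp_all add: frag_extend_diff)

text \<open>A boundary of the quandle goes to \<open>(1 - \<phi>) v\<close> modulo boundaries, with the same \<open>v\<close> whose boundary is
  the 1-chain of its edges. If this 1-chain vanishes, \<open>v\<close> is a cycle, and the image is trivial among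
  the coinvariants.\<close>

lemma prism_boundary:
  assumes "c \<in> BQ"
  shows "\<exists>v \<in> C 2. edge c = dG v \<and> prism c - (v - push \<phi> v) \<in> BG"
proof -
  define K where "K = {c. \<exists>v \<in> C 2. edge c = dG v \<and> prism c - (v - push \<phi> v) \<in> BG}"
  have K: "additive_group K"
    unfolding additive_group_def
  proof (intro conjI ballI)
    show "0 \<in> K"
      by (auto simp: K_def BG_zero intro!: bexI [of _ 0])
    fix c c' assume "c \<in> K" "c' \<in> K"
    then obtain v v' where v: "v \<in> C 2" "edge c = dG v" "prism c - (v - push \<phi> v) \<in> BG"
      "v' \<in> C 2" "edge c' = dG v'" "prism c' - (v' - push \<phi> v') \<in> BG"
      by (auto simp: K_def)
    have "prism (c - c') - ((v - v') - push \<phi> (v - v'))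
      = (prism c - (v - push \<phi> v)) - (prism c' - (v' - push \<phi> v'))"
      by (simp add: frag_extend_diff)
    also have "\<dots> \<in> BG"
      by (rule BG_diff [OF v(3,6)])
    finally show "c - c' \<in> K"
      using v unfolding K_def by (intro CollectI bexI [of _ "v - v'"]) (simp_all add: frag_extend_diff)
  qed
  obtain t e where te: "t \<in> C 3" "e \<in> chains_on diag" "c = dQ t + e"
    using assms by (rule BQ_E)
  have "e \<in> K"
  proof (rule additive_map_in [OF te(2) K, of "\<lambda>e. e"])
    fix xs assume "xs \<in> diag"
    then show "frag_of xs \<in> K"
      unfolding K_def
      by (intro CollectI bexI [of _ "frag_of [\<one>, \<one>]"]) (auto simp: diag_def bar_boundary_2 BG_zero)
  qed auto
  moreover have "dQ t \<in> K"
  proof (rule additive_map_in [OF te(1) K])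
    fix xs assume "xs \<in> tuples (carrier G) 3"
    then show "dQ (frag_of xs) \<in> K"
    proof (elim tuple3E)
      fix x y z assume xyz: "x \<in> carrier G" "y \<in> carrier G" "z \<in> carrier G" and xs: "xs = [x, y, z]"
      define a where "a = y \<otimes> inv x"
      define b where "b = z \<otimes> inv y"
      let ?p = "(x \<star> y) \<star> z"
      have ab: "a \<in> carrier G" "b \<in> carrier G"
        using xyz by (simp_all add: a_def b_def)
      have a_mult: "a \<otimes> x = y" "\<phi> a \<otimes> (x \<star> y) = y"
        using xyz mult_inv_mult phi_mult_star by (simp_all add: a_def del: phi.hom_mult phi.hom_inv)
      have y_star: "(y \<star> z) \<otimes> inv (x \<star> z) = \<phi> a"
        using xyz by (simp add: star_mult_inv_star a_def)
      have a_star: "\<phi> a \<otimes> (x \<star> z) = y \<star> z"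
        using xyz mult_inv_mult [of "x \<star> z" "y \<star> z"] y_star by simp
      have a_star2: "\<phi> (\<phi> a) \<otimes> ?p = y \<star> z"
        using mult_star [of "\<phi> a" "x \<star> y" z] a_mult xyz ab by simp
      have za: "z \<otimes> inv x = b \<otimes> a"
        using xyz by (simp add: a_def b_def m_assoc) (simp add: m_assoc [symmetric])
      have "y \<otimes> inv (x \<star> y) = \<phi> a"
        unfolding a_def using xyz by (intro mult_inv_star)
      then have "b \<otimes> \<phi> a = b \<otimes> (y \<otimes> inv (x \<star> y))"
        by simp
      also have "\<dots> = (b \<otimes> y) \<otimes> inv (x \<star> y)"
        using xyz ab by (simp add: m_assoc)
      also have "b \<otimes> y = z"
        using xyz mult_inv_mult by (simp add: b_def)
      finally have zb: "z \<otimes> inv (x \<star> y) = b \<otimes> \<phi> a" ..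
      have p: "(x \<star> z) \<star> (y \<star> z) = ?p"
        using star_distrib [OF xyz] by simp
      \<comment> \<open>The 1-chain of edges of the boundary is \<open>[b a] - [b \<phi>(a)] - [a] + [\<phi>(a)]\<close>, because
          \<open>b a = z x\<^sup>-\<^sup>1\<close> and \<open>b \<phi>(a) = z (x \<star> y)\<^sup>-\<^sup>1\<close>.\<close>
      let ?v = "frag_of [b, \<phi> a] - frag_of [b, a]"
      have "edge (dQ (frag_of xs)) = dG ?v"
        using xyz
        by (simp add: xs rack_boundary_3 bar_boundary_2 frag_extend_diff frag_extend_add za zb y_star
            flip: a_def)
      \<comment> \<open>The four bars are the cones \<open>\<langle>z, y, x, 1\<rangle>\<close>, \<open>\<langle>z, y, x \<star> y, 1\<rangle>\<close>, \<open>\<langle>z, y \<star> z, x \<star> z, 1\<rangle>\<close> and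
          \<open>\<langle>z, y \<star> z, (x \<star> y) \<star> z, 1\<rangle>\<close>. The
          faces opposite to the first and to the second vertex make up the image of the boundary, those
          opposite to the third cancel, and those opposite to \<open>1\<close> make up \<open>(1 - \<phi>) ?v\<close>.\<close>
      moreover have "prism (dQ (frag_of xs)) - (?v - push \<phi> ?v) =
        - (bar_boundary_tuple G [b, a, x] - bar_boundary_tuple G [b, \<phi> a, x \<star> y]
           - bar_boundary_tuple G [\<phi> b, \<phi> a, x \<star> z] + bar_boundary_tuple G [\<phi> b, \<phi> (\<phi> a), ?p])"
        using ab
        by (simp add: xs rack_boundary_3 bar_boundary_3 frag_extend_diff frag_extend_add
            za zb y_star a_mult a_star a_star2 p flip: a_def)
      moreover have "\<dots> \<in> BG"
        using xyz ab by (intro BG_minus BG_add BG_diff dG_in_BG) auto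
      ultimately show ?thesis
        unfolding K_def using ab by (intro CollectI bexI [of _ ?v]) auto
    qed
  qed (simp add: frag_extend_diff)
  ultimately have "c \<in> K"
    using additive_group_add [OF K] te(3) by simp
  then show ?thesis
    by (simp add: K_def)
qed

end

section \<open>The two constructions are inverse to each other\<close>

context connected_group_automorphism
begin

text \<open>For \<open>a = y x\<^sup>-\<^sup>1\<close>, the loops of the two simplices leave the path \<open>\<gamma>\<^sub>a x\<close> from \<open>x\<close> to \<open>y\<close> and the path
  \<open>\<gamma>\<^bsub>\<phi>(a)\<^esub> (x \<star> y)\<close> from \<open>x \<star> y\<close> to \<open>y\<close>. Up to the defect of \<open>a\<close>, the second is the image of the first under
  \<open>_ \<star> y\<close>, so by \<open>push_star_cong\<close> their difference is \<open>(x, y) - (y, y)\<close> modulo boundaries.\<close>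

lemma loop_prism:
  assumes "c \<in> C 2"
  shows "loop (prism c) - (paths (dQ c) + c + defect (edge c)) \<in> BQ"
proof (rule additive_map_in [OF assms additive_BQ])
  fix xs assume "xs \<in> tuples (carrier G) 2"
  then show "loop (prism (frag_of xs))
      - (paths (dQ (frag_of xs)) + frag_of xs + defect (edge (frag_of xs))) \<in> BQ"
  proof (elim tuple2E)
    fix x y assume xy: "x \<in> carrier G" "y \<in> carrier G" and xs: "xs = [x, y]"
    define a where "a = y \<otimes> inv x"
    define d where "d = rtrans x (path a)"
    define D where "D = defect_tuple [a]"
    have a: "a \<in> carrier G" "a \<otimes> x = y" "\<phi> a \<otimes> (x \<star> y) = y"
      using xy mult_inv_mult phi_mult_star by (simp_all add: a_def del: phi.hom_mult phi.hom_inv)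
    have d: "d \<in> C 2" "dQ d = frag_of [x] - frag_of [y]"
      using a xy by (simp_all add: d_def rtrans_closed path_closed dQ_rtrans dQ_path frag_extend_diff)
    have 1: "push (\<lambda>p. p \<star> y) d - d + frag_of [x, y] - frag_of [y, y] \<in> BQ"
      using push_star_cong [OF d(1) xy(2)] by (simp add: d(2) frag_extend_diff algebra_simps)
    have 2: "rtrans (x \<star> y) D - D \<in> BQ"
      unfolding D_def using a xy by (intro rtrans_cycle defect_cycle) auto
    have "rtrans (x \<star> y) (push \<phi> (path a)) = push (\<lambda>p. p \<star> y) d"
      unfolding d_def push_push
      by (rule push_cong [OF path_closed [OF a(1)]]) (use xy in \<open>simp add: mult_star\<close>)
    then have 3: "rtrans (x \<star> y) D = push (\<lambda>p. p \<star> y) d - rtrans (x \<star> y) (path (\<phi> a))"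
      by (simp add: D_def frag_extend_diff)
    have "loop (prism (frag_of xs)) - (paths (dQ (frag_of xs)) + frag_of xs + defect (edge (frag_of xs)))
       = (rtrans (x \<star> y) D - D) - (push (\<lambda>p. p \<star> y) d - d + frag_of [x, y] - frag_of [y, y])
          - frag_of [y, y]"
      unfolding 3
      by (simp add: xs frag_extend_diff rack_boundary_2 a d_def D_def flip: a_def)
    also have "\<dots> \<in> BQ"
      by (intro BQ_diff 1 2 diag_in_BQ xy)
    finally show ?thesis .
  qed
qed (simp add: frag_extend_diff frag_extend_add)

lemma edge_loop:
  assumes "u \<in> C 2"
  shows "edge (loop u) = edge (paths (dG u))"
proof (rule additive_map_eq [OF assms, of "\<lambda>u. edge (loop u)" "\<lambda>u. edge (paths (dG u))"])
  fix xs assume "xs \<in> tuples (carrier G) 2"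
  then show "edge (loop (frag_of xs)) = edge (paths (dG (frag_of xs)))"
    by (elim tuple2E)
      (simp add: bar_boundary_2 frag_extend_diff frag_extend_add edge_rtrans path_closed)
qed (simp_all add: frag_extend_diff)

text \<open>The bar \<open>[1|h]\<close> is homologous to \<open>[1|1]\<close> for every \<open>h\<close>. Since \<open>\<partial>[g|h]\<close> has coefficient sum 1, the
  additive map that sends every \<open>[g]\<close> to \<open>[1|1]\<close> sends \<open>\<partial>[g|h]\<close> to \<open>[1|1]\<close>; so these contributions
  cancel on cycles.\<close>

abbreviation "ones \<equiv> frag_extend (\<lambda>_. frag_of [\<one>, \<one>])"

lemma prism_loop:
  assumes "u \<in> C 2"
  shows "prism (loop u) - (prism (paths (dG u)) + u - ones (dG u)) \<in> BG"
proof (rule additive_map_in [OF assms additive_BG])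
  fix xs assume "xs \<in> tuples (carrier G) 2"
  then show "prism (loop (frag_of xs))
      - (prism (paths (dG (frag_of xs))) + frag_of xs - ones (dG (frag_of xs))) \<in> BG"
  proof (elim tuple2E)
    fix g h assume gh: "g \<in> carrier G" "h \<in> carrier G" and xs: "xs = [g, h]"
    have "prism (loop (frag_of xs))
      - (prism (paths (dG (frag_of xs))) + frag_of xs - ones (dG (frag_of xs)))
      = (prism (rtrans h (path g)) - prism (path g) + attach h (dQ (path g)))
        - bar_boundary_tuple G [\<one>, \<one>, h]"
      using gh by (simp add: xs bar_boundary_2 bar_boundary_3 frag_extend_diff frag_extend_add dQ_path)
    \<comment> \<open>The end points \<open>1\<close> and \<open>g\<close> of the path contribute \<open>[g|h] - [1|h]\<close>, and \<open>\<partial>[1|1|h] = [1|h] - [1|1]\<close>.\<close>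
    also have "\<dots> \<in> BG"
      using gh by (intro BG_diff prism_rtrans dG_in_BG path_closed) auto
    finally show ?thesis .
  qed
qed (simp add: frag_extend_diff frag_extend_add)

text \<open>A preimage of \<open>c\<close> is its image in the chains of \<open>G\<close>, corrected by \<open>(1 - \<phi>) v\<close> to become a cycle.\<close>

lemma loop_surjective:
  assumes iso: "one_minus (abelianization G) (abelianization_map G \<phi>)
      \<in> iso (abelianization G) (abelianization G)"
    and c: "c \<in> C 2" "dQ c = 0"
  obtains u where "u \<in> C 2" "dG u = 0" "c - loop u \<in> BQ"
proof -
  have "edge c - push \<phi> (edge c) \<in> BG1"
    using dG_prism [OF c(1)] prism_closed [OF c(1)] c(2) by (intro image_eqI [of _ _ "prism c"]) simp_all
  then have "edge c \<in> BG1"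
    by (rule one_minus_injective_on_H1 [OF iso edge_closed [OF c(1)]])
  then obtain v where v: "v \<in> C 2" "edge c = dG v"
    by blast
  define u where "u = prism c - (v - push \<phi> v)"
  show thesis
  proof
    show "u \<in> C 2"
      unfolding u_def using v c by (intro chains_on_diff prism_closed push_phi_closed)
    show "dG u = 0"
      using dG_prism [OF c(1)] c(2) v by (simp add: u_def frag_extend_diff dG_push_phi)
    have "loop (prism c) - (c + defect (edge c)) \<in> BQ"
      using loop_prism [OF c(1)] c(2) by simp
    moreover have "loop v - loop (push \<phi> v) - defect (edge c) \<in> BQ"
      using loop_phi [OF v(1)] v(2) by simp
    ultimately have "(loop v - loop (push \<phi> v) - defect (edge c))
        - (loop (prism c) - (c + defect (edge c))) \<in> BQ"
      by (rule BQ_diff [rotated])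
    then show "c - loop u \<in> BQ"
      by (simp add: u_def frag_extend_diff frag_extend_add algebra_simps)
  qed
qed

text \<open>If the loop of \<open>u\<close> is a boundary, then mapping it back to \<open>G\<close> expresses \<open>u\<close> as \<open>(1 - \<phi>) v\<close> modulo
  boundaries, and the 1-chain \<open>\<partial>v\<close> of edges is zero because \<open>u\<close> is a cycle.\<close>

lemma loop_kernel:
  assumes u: "u \<in> C 2" "dG u = 0"
  shows "loop u \<in> BQ \<longleftrightarrow> (\<exists>z \<in> C 2. dG z = 0 \<and> u - (z - push \<phi> z) \<in> BG)"
proof
  assume "loop u \<in> BQ"
  then obtain v where v: "v \<in> C 2" "edge (loop u) = dG v" "prism (loop u) - (v - push \<phi> v) \<in> BG"
    using prism_boundary by blast
  have "dG v = 0"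
    using v(2) edge_loop [OF u(1)] u(2) by simp
  moreover have "prism (loop u) - u \<in> BG"
    using prism_loop [OF u(1)] u(2) by simp
  then have "(prism (loop u) - (v - push \<phi> v)) - (prism (loop u) - u) \<in> BG"
    by (rule BG_diff [OF v(3)])
  ultimately show "\<exists>z \<in> C 2. dG z = 0 \<and> u - (z - push \<phi> z) \<in> BG"
    using v(1) by (intro bexI [of _ v]) (simp_all add: algebra_simps)
next
  assume "\<exists>z \<in> C 2. dG z = 0 \<and> u - (z - push \<phi> z) \<in> BG"
  then obtain z where z: "z \<in> C 2" "dG z = 0" "u - (z - push \<phi> z) \<in> BG"
    by blast
  have "loop (u - (z - push \<phi> z)) + (loop z - loop (push \<phi> z) - defect (dG z)) \<in> BQ"
    by (intro BQ_add loop_boundary loop_phi z)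
  then show "loop u \<in> BQ"
    by (simp add: z(2) frag_extend_diff)
qed

end

section \<open>Quotients and homology of complexes of abelian groups\<close>

lemma iso_of_equal_kernels:
  assumes "group A" "group H" "group K" and f: "f \<in> hom A H" and g: "g \<in> hom A K"
    and surj: "f ` carrier A = carrier H" "g ` carrier A = carrier K"
    and ker: "\<And>a. a \<in> carrier A \<Longrightarrow> f a = \<one>\<^bsub>H\<^esub> \<longleftrightarrow> g a = \<one>\<^bsub>K\<^esub>"
  shows "H \<cong> K"
proof -
  interpret f: group_hom A H f
    using assms by (simp add: group_hom_def group_hom_axioms_def)
  interpret g: group_hom A K g
    using assms by (simp add: group_hom_def group_hom_axioms_def)
  have "kernel A H f = kernel A K g"
    using ker by (auto simp: kernel_def)
  moreover have "A Mod kernel A H f \<cong> H" "A Mod kernel A K g \<cong> K"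
    using f.FactGroup_iso g.FactGroup_iso surj by auto
  moreover have "group (A Mod kernel A H f)"
    using f.normal_kernel by (rule normal.factorgroup_is_group)
  ultimately show ?thesis
    by (metis group.iso_sym iso_trans)
qed

lemma comm_group_restrict_carrier:
  assumes "comm_group A" "subgroup H A"
  shows "comm_group (A\<lparr>carrier := H\<rparr>)"
proof -
  interpret A: comm_group A by fact
  interpret H: subgroup H A by fact
  show ?thesis
    by (rule group.group_comm_groupI)
      (auto intro: H.subgroup_is_group A.group_axioms A.m_comm)
qed

lemma coset_map:
  assumes "comm_group N" "subgroup B N"
  shows coset_map_hom: "(\<lambda>a. B #>\<^bsub>N\<^esub> a) \<in> hom N (N Mod B)"
    and coset_map_image: "(\<lambda>a. B #>\<^bsub>N\<^esub> a) ` carrier N = carrier (N Mod B)"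
    and coset_map_kernel: "a \<in> carrier N \<Longrightarrow> B #>\<^bsub>N\<^esub> a = \<one>\<^bsub>N Mod B\<^esub> \<longleftrightarrow> a \<in> B"
    and group_quotient: "group (N Mod B)"
proof -
  interpret N: comm_group N by fact
  interpret B: normal B N
    using assms N.normal_iff_subgroup by blast
  show "(\<lambda>a. B #>\<^bsub>N\<^esub> a) \<in> hom N (N Mod B)"
    by (rule B.r_coset_hom_Mod)
  show "(\<lambda>a. B #>\<^bsub>N\<^esub> a) ` carrier N = carrier (N Mod B)"
    by (simp add: carrier_FactGroup)
  show "B #>\<^bsub>N\<^esub> a = \<one>\<^bsub>N Mod B\<^esub> \<longleftrightarrow> a \<in> B" if "a \<in> carrier N"
    unfolding one_FactGroup
    using N.coset_join1 [OF _ that assms(2)] N.coset_join2 [OF that assms(2)] by blast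
  show "group (N Mod B)"
    by (rule B.factorgroup_is_group)
qed

lemma Mod_map_hom:
  assumes "comm_group G" "comm_group H" "subgroup K G" "subgroup L H"
    and f: "f \<in> hom G H" "f ` K \<subseteq> L"
  shows "Mod_map H L f \<in> hom (G Mod K) (H Mod L)"
proof -
  interpret G: comm_group G by fact
  interpret H: comm_group H by fact
  interpret K: normal K G
    using assms G.normal_iff_subgroup by blast
  interpret L: normal L H
    using assms H.normal_iff_subgroup by blast
  interpret f: group_hom G H f
    using f by (simp add: group_hom_def group_hom_axioms_def)
  have map: "Mod_map H L f (K #>\<^bsub>G\<^esub> x) = L #>\<^bsub>H\<^esub> f x" if "x \<in> carrier G" for x
    using assms that by (intro Mod_map_r_coset) auto
  show ?thesis
  proof (rule homI)
    fix U assume "U \<in> carrier (G Mod K)"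
    then show "Mod_map H L f U \<in> carrier (H Mod L)"
      by (auto simp: carrier_FactGroup map)
  next
    fix U V assume "U \<in> carrier (G Mod K)" "V \<in> carrier (G Mod K)"
    then obtain x y where "x \<in> carrier G" "U = K #>\<^bsub>G\<^esub> x" "y \<in> carrier G" "V = K #>\<^bsub>G\<^esub> y"
      by (auto simp: carrier_FactGroup)
    then show "Mod_map H L f (U \<otimes>\<^bsub>G Mod K\<^esub> V) = Mod_map H L f U \<otimes>\<^bsub>H Mod L\<^esub> Mod_map H L f V"
      by (simp add: K.rcos_sum L.rcos_sum map)
  qed
qed

lemma cycles_boundaries:
  assumes "comm_group (C n)" "group (C (n - 1))" "group (C (Suc n))"
    and d: "d n \<in> hom (C n) (C (n - 1))" "d (Suc n) \<in> hom (C (Suc n)) (C n)"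
    and dd: "\<And>x. x \<in> carrier (C (Suc n)) \<Longrightarrow> d n (d (Suc n) x) = \<one>\<^bsub>C (n - 1)\<^esub>"
  shows comm_group_cycles: "comm_group (cycles C d n)"
    and subgroup_boundaries: "subgroup (boundaries C d n) (cycles C d n)"
proof -
  interpret C: comm_group "C n" by fact
  interpret d: group_hom "C n" "C (n - 1)" "d n"
    using assms C.group_axioms by (simp add: group_hom_def group_hom_axioms_def)
  interpret d': group_hom "C (Suc n)" "C n" "d (Suc n)"
    using assms C.group_axioms by (simp add: group_hom_def group_hom_axioms_def)
  show "comm_group (cycles C d n)"
    unfolding cycles_def by (intro comm_group_restrict_carrier C.comm_group_axioms d.subgroup_kernel)
  show "subgroup (boundaries C d n) (cycles C d n)"
    unfolding cycles_def boundaries_def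
    by (rule C.subgroup_incl [OF d'.img_is_subgroup d.subgroup_kernel])
      (auto simp: kernel_def dd)
qed

lemma generate_frag_of:
  assumes "T \<subseteq> S"
  shows "generate (free_Abelian_group S) (frag_of ` T) = chains_on T"
proof
  interpret F: group "free_Abelian_group S" by simp
  have gen_in: "frag_of ` T \<subseteq> carrier (free_Abelian_group S)"
    using assms by auto
  have T_sub: "chains_on T \<subseteq> carrier (free_Abelian_group S)"
    using assms by (auto simp: chains_on_def)
  have "subgroup (chains_on T) (free_Abelian_group S)"
  proof (rule F.subgroupI [OF T_sub])
    show "chains_on T \<noteq> {}"
      using chains_on_zero by blast
  next
    fix c assume c: "c \<in> chains_on T"
    then have "Poly_Mapping.keys c \<subseteq> S"
      using T_sub by fastforce
    then show "inv\<^bsub>free_Abelian_group S\<^esub> c \<in> chains_on T"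
      using c by simp
  next
    fix c d assume "c \<in> chains_on T" "d \<in> chains_on T"
    then show "c \<otimes>\<^bsub>free_Abelian_group S\<^esub> d \<in> chains_on T"
      by simp
  qed
  then show "generate (free_Abelian_group S) (frag_of ` T) \<subseteq> chains_on T"
    by (intro F.generate_subgroup_incl) auto
  have sub: "subgroup (generate (free_Abelian_group S) (frag_of ` T)) (free_Abelian_group S)"
    using gen_in by (rule F.generate_is_subgroup)
  have grp: "additive_group (generate (free_Abelian_group S) (frag_of ` T))"
    unfolding additive_group_def
  proof (intro conjI ballI)
    show "0 \<in> generate (free_Abelian_group S) (frag_of ` T)"
      using subgroup.one_closed [OF sub] by simp
    fix a b assume ab: "a \<in> generate (free_Abelian_group S) (frag_of ` T)"
      "b \<in> generate (free_Abelian_group S) (frag_of ` T)"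
    have "b \<in> carrier (free_Abelian_group S)"
      using ab(2) by (rule subgroup.mem_carrier [OF sub])
    then show "a - b \<in> generate (free_Abelian_group S) (frag_of ` T)"
      using subgroup.m_closed [OF sub ab(1) subgroup.m_inv_closed [OF sub ab(2)]] by simp
  qed
  show "chains_on T \<subseteq> generate (free_Abelian_group S) (frag_of ` T)"
  proof
    fix c assume "c \<in> chains_on T"
    then show "c \<in> generate (free_Abelian_group S) (frag_of ` T)"
      by (rule additive_map_in [OF _ grp, of _ _ "\<lambda>c. c"]) (auto intro: generate.incl)
  qed
qed

lemma comm_group_tuple_chains: "comm_group (tuple_chains S n)"
  unfolding tuple_chains_def by (rule abelian_free_Abelian_group)

lemma mult_tuple_chains [simp]: "a \<otimes>\<^bsub>tuple_chains S n\<^esub> b = a + b"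
  by (simp add: tuple_chains_def)

lemma one_tuple_chains [simp]: "\<one>\<^bsub>tuple_chains S n\<^esub> = 0"
  by (simp add: tuple_chains_def)

lemma inv_tuple_chains [simp]:
  "c \<in> chains_on (tuples S n) \<Longrightarrow> inv\<^bsub>tuple_chains S n\<^esub> c = - c"
  by (simp add: tuple_chains_def chains_on_def tuples_def)

lemma additive_hom:
  assumes "\<And>a b. f (a + b) = f a + f b"
    and "\<And>c. c \<in> chains_on (tuples S n) \<Longrightarrow> f c \<in> chains_on (tuples T m)"
  shows "f \<in> hom (tuple_chains S n) (tuple_chains T m)"
  using assms by (intro homI) (simp_all add: carrier_tuple_chains)

lemma coset_eq_iff:
  assumes "subgroup B (tuple_chains S n)" "c \<in> chains_on (tuples S n)" "c' \<in> chains_on (tuples S n)"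
  shows "B #>\<^bsub>tuple_chains S n\<^esub> c = B #>\<^bsub>tuple_chains S n\<^esub> c' \<longleftrightarrow> c - c' \<in> B"
proof -
  interpret T: comm_group "tuple_chains S n"
    by (rule comm_group_tuple_chains)
  have carr: "c \<in> carrier (tuple_chains S n)" "c' \<in> carrier (tuple_chains S n)"
    using assms by (simp_all add: carrier_tuple_chains)
  have B: "B \<subseteq> carrier (tuple_chains S n)"
    using assms(1) by (rule subgroup.subset)
  have diff: "c \<otimes>\<^bsub>tuple_chains S n\<^esub> inv\<^bsub>tuple_chains S n\<^esub> c' = c - c'"
    using assms by simp
  have carr': "c - c' \<in> carrier (tuple_chains S n)"
    using assms by (simp add: carrier_tuple_chains)
  have "B #>\<^bsub>tuple_chains S n\<^esub> c = B #>\<^bsub>tuple_chains S n\<^esub> c' \<longleftrightarrow>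
      B #>\<^bsub>tuple_chains S n\<^esub> (c - c') = B"
    using T.coset_mult_inv1 [OF _ carr B] T.coset_mult_inv2 [OF _ carr B] unfolding diff by blast
  also have "\<dots> \<longleftrightarrow> c - c' \<in> B"
    using T.coset_join1 [OF _ carr' assms(1)] T.coset_join2 [OF carr' assms(1)] by blast
  finally show ?thesis .
qed

section \<open>Coinvariants of the second homology of the group\<close>

context group_automorphism
begin

abbreviation "T n \<equiv> tuple_chains (carrier G) n"
abbreviation "Zg \<equiv> cycles T (\<lambda>_. dG) 2"
abbreviation "Hg \<equiv> group_homology G 2"
abbreviation "phi_H \<equiv> group_homology_map G 2 \<phi>"

lemma carrier_Zg: "carrier Zg = {u \<in> C 2. dG u = 0}"
  by (simp add: cycles_def kernel_def carrier_tuple_chains)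

lemma mult_Zg [simp]: "u \<otimes>\<^bsub>Zg\<^esub> v = u + v"
  by (simp add: cycles_def)

lemma boundaries_BG: "boundaries T (\<lambda>_. dG) 2 = BG"
  by (simp add: boundaries_def BG_def carrier_tuple_chains)

lemma Zg_BG: shows comm_group_Zg: "comm_group Zg" and subgroup_BG: "subgroup BG Zg"
proof -
  have d: "dG \<in> hom (T 2) (T (2 - 1))" "dG \<in> hom (T (Suc 2)) (T 2)"
    using dG_closed dG_closed3
    by (auto intro!: additive_hom simp: frag_extend_add)
  have groups: "comm_group (T n)" "group (T n)" for n
    using comm_group_tuple_chains comm_group.axioms(2) by auto
  have dd: "dG (dG x) = \<one>\<^bsub>T (2 - 1)\<^esub>" if "x \<in> carrier (T (Suc 2))" for x
    using that by (simp add: carrier_tuple_chains dG_dG)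
  show "comm_group Zg"
    by (rule comm_group_cycles [of T 2 "\<lambda>_. dG", OF groups(1) groups(2) groups(2) d dd])
  have "subgroup (boundaries T (\<lambda>_. dG) 2) Zg"
    by (rule subgroup_boundaries [of T 2 "\<lambda>_. dG", OF groups(1) groups(2) groups(2) d dd])
  then show "subgroup BG Zg"
    by (simp only: boundaries_BG)
qed

lemma inv_Zg:
  assumes "u \<in> carrier Zg" shows "inv\<^bsub>Zg\<^esub> u = - u"
proof (rule group.inv_equality)
  show "group Zg"
    using comm_group_Zg by (rule comm_group.axioms(2))
  show "- u \<otimes>\<^bsub>Zg\<^esub> u = \<one>\<^bsub>Zg\<^esub>"
    by (simp add: cycles_def)
  show "- u \<in> carrier Zg"
    using assms by (simp add: carrier_Zg frag_extend_minus)
qed (rule assms)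

abbreviation "homology_class u \<equiv> BG #>\<^bsub>Zg\<^esub> u"

lemma Hg_quotient: "Hg = Zg Mod BG"
  by (simp add: group_homology_def homology_def boundaries_BG)

lemma comm_group_Hg: "comm_group Hg"
  unfolding Hg_quotient by (rule comm_group.abelian_FactGroup [OF comm_group_Zg subgroup_BG])

lemmas homology_class_hom = coset_map_hom [OF comm_group_Zg subgroup_BG, folded Hg_quotient]
  and homology_class_image = coset_map_image [OF comm_group_Zg subgroup_BG, folded Hg_quotient]

lemma push_phi_Zg: "z \<in> carrier Zg \<Longrightarrow> push \<phi> z \<in> carrier Zg"
  by (simp add: carrier_Zg dG_push_phi push_phi_closed)

lemma push_phi_BG: "push \<phi> ` BG \<subseteq> BG"
proof
  fix b assume "b \<in> push \<phi> ` BG"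
  then obtain t where "t \<in> C 3" "b = push \<phi> (dG t)"
    unfolding BG_def by blast
  then show "b \<in> BG"
    unfolding BG_def by (intro image_eqI [of _ _ "push \<phi> t"]) (simp_all add: dG_push_phi3 push_phi_closed)
qed

lemma phi_H_class:
  assumes "z \<in> carrier Zg"
  shows "phi_H (homology_class z) = homology_class (push \<phi> z)"
  unfolding group_homology_map_def boundaries_BG
proof (rule Mod_map_r_coset [OF _ _ subgroup_BG subgroup_BG _ push_phi_BG assms])
  show "group Zg" "group Zg"
    using comm_group_Zg by (simp_all add: comm_group_def)
  show "push \<phi> \<in> hom Zg Zg"
    by (rule homI) (simp_all add: push_phi_Zg frag_extend_add)
qed

lemma one_minus_class:
  assumes "z \<in> carrier Zg"
  shows "one_minus Hg phi_H (homology_class z) = homology_class (z - push \<phi> z)"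
proof -
  interpret Zg: comm_group Zg by (rule comm_group_Zg)
  interpret p: group_hom Zg Hg homology_class
    using homology_class_hom comm_group_Hg Zg.group_axioms
    by (simp add: group_hom_def group_hom_axioms_def comm_group_def)
  have "one_minus Hg phi_H (homology_class z) = homology_class (z \<otimes>\<^bsub>Zg\<^esub> inv\<^bsub>Zg\<^esub> push \<phi> z)"
    unfolding one_minus_def phi_H_class [OF assms]
    using assms push_phi_Zg [OF assms] by (simp only: p.hom_mult p.hom_inv Zg.inv_closed)
  then show ?thesis
    using push_phi_Zg [OF assms] by (simp add: inv_Zg)
qed

lemma diff_push_phi_Zg: "z \<in> carrier Zg \<Longrightarrow> z - push \<phi> z \<in> carrier Zg"
  using push_phi_Zg by (simp add: carrier_Zg frag_extend_diff)

lemma subgroup_one_minus_image: "subgroup (one_minus Hg phi_H ` carrier Hg) Hg"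
proof -
  have "(\<lambda>z. z - push \<phi> z) \<in> hom Zg Zg"
    by (rule homI) (simp_all add: diff_push_phi_Zg frag_extend_add)
  then have "homology_class \<circ> (\<lambda>z. z - push \<phi> z) \<in> hom Zg Hg"
    using homology_class_hom by (rule Group.hom_compose)
  then interpret h: group_hom Zg Hg "homology_class \<circ> (\<lambda>z. z - push \<phi> z)"
    using comm_group_Zg comm_group_Hg by (simp add: group_hom_def group_hom_axioms_def comm_group_def)
  have "one_minus Hg phi_H ` carrier Hg = (homology_class \<circ> (\<lambda>z. z - push \<phi> z)) ` carrier Zg"
    unfolding homology_class_image [symmetric] image_image comp_def
    by (rule image_cong) (simp_all add: one_minus_class)
  then show ?thesis
    using h.img_is_subgroup by simp
qed

abbreviation "coinvariant_class u \<equiv> (one_minus Hg phi_H ` carrier Hg) #>\<^bsub>Hg\<^esub> homology_class u"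

lemma coinvariant_class:
  shows coinvariant_class_hom: "coinvariant_class \<in> hom Zg (coinvariants Hg phi_H)"
    and coinvariant_class_image: "coinvariant_class ` carrier Zg = carrier (coinvariants Hg phi_H)"
    and coinvariant_class_one: "u \<in> carrier Zg \<Longrightarrow>
      coinvariant_class u = \<one>\<^bsub>coinvariants Hg phi_H\<^esub> \<longleftrightarrow>
      (\<exists>z \<in> carrier Zg. u - (z - push \<phi> z) \<in> BG)"
    and group_coinvariants: "group (coinvariants Hg phi_H)"
proof -
  note q = coset_map [OF comm_group_Hg subgroup_one_minus_image, folded coinvariants_def]
  show "coinvariant_class \<in> hom Zg (coinvariants Hg phi_H)"
    using Group.hom_compose [OF homology_class_hom q(1)] by (simp add: comp_def)
  show "coinvariant_class ` carrier Zg = carrier (coinvariants Hg phi_H)"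
    unfolding q(2) [symmetric] homology_class_image [symmetric] by (simp add: image_image)
  show "group (coinvariants Hg phi_H)"
    by (rule q(4))
  assume u: "u \<in> carrier Zg"
  interpret Zg: comm_group Zg by (rule comm_group_Zg)
  have class_eq: "homology_class u = homology_class v \<longleftrightarrow> u - v \<in> BG" if v: "v \<in> carrier Zg" for v
  proof -
    have BG: "BG \<subseteq> carrier Zg"
      using subgroup_BG by (rule subgroup.subset)
    have diff: "u \<otimes>\<^bsub>Zg\<^esub> inv\<^bsub>Zg\<^esub> v = u - v"
      using v by (simp add: inv_Zg)
    have uv: "u - v \<in> carrier Zg"
      using u v by (simp add: carrier_Zg frag_extend_diff)
    show ?thesis
      using Zg.coset_mult_inv1 [OF _ u v BG] Zg.coset_mult_inv2 [OF _ u v BG]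
        Zg.coset_join1 [OF _ uv subgroup_BG] Zg.coset_join2 [OF uv subgroup_BG]
      unfolding diff by blast
  qed
  have "homology_class u \<in> carrier Hg"
    using u homology_class_image by blast
  then have "coinvariant_class u = \<one>\<^bsub>coinvariants Hg phi_H\<^esub> \<longleftrightarrow>
      homology_class u \<in> one_minus Hg phi_H ` carrier Hg"
    by (rule q(3))
  also have "\<dots> \<longleftrightarrow> (\<exists>z \<in> carrier Zg. homology_class u = homology_class (z - push \<phi> z))"
    unfolding homology_class_image [symmetric] image_image image_iff
    by (rule bex_cong) (simp_all add: one_minus_class)
  also have "\<dots> \<longleftrightarrow> (\<exists>z \<in> carrier Zg. u - (z - push \<phi> z) \<in> BG)"
    by (rule bex_cong) (simp_all only: class_eq diff_push_phi_Zg)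
  finally show "coinvariant_class u = \<one>\<^bsub>coinvariants Hg phi_H\<^esub> \<longleftrightarrow>
      (\<exists>z \<in> carrier Zg. u - (z - push \<phi> z) \<in> BG)" .
qed

section \<open>Second homology of the quandle\<close>

abbreviation "Alex \<equiv> gen_Alexander G \<phi>"

definition degenerate_tuples :: "nat \<Rightarrow> 'a list set"
  where "degenerate_tuples n = {xs \<in> tuples (carrier G) n. \<exists>i. Suc i < n \<and> xs ! i = xs ! Suc i}"

lemma degenerate_chains_eq: "degenerate_chains Alex n = chains_on (degenerate_tuples n)"
proof -
  have "degenerate_tuples n = {xs. length xs = n \<and> set xs \<subseteq> carrier Alex \<and>
      (\<exists>i. Suc i < n \<and> xs ! i = xs ! Suc i)}"
    by (auto simp: degenerate_tuples_def)
  moreover have "degenerate_tuples n \<subseteq> tuples (carrier G) n"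
    by (auto simp: degenerate_tuples_def)
  ultimately show ?thesis
    using generate_frag_of [of "degenerate_tuples n" "tuples (carrier G) n"]
    by (simp add: degenerate_chains_def tuple_chains_def tuples_def)
qed

lemma degenerate_tuples_1: "degenerate_tuples 1 = {}"
  by (simp add: degenerate_tuples_def)

lemma degenerate_tuples_2: "degenerate_tuples 2 = diag"
proof
  show "degenerate_tuples 2 \<subseteq> diag"
  proof
    fix xs assume "xs \<in> degenerate_tuples 2"
    then show "xs \<in> diag"
      unfolding degenerate_tuples_def by (auto elim!: tuple2E simp: diag_def simp del: mem_tuples)
  qed
  show "diag \<subseteq> degenerate_tuples 2"
    by (auto simp: degenerate_tuples_def diag_def)
qed

lemma dQ_degenerate:
  assumes "c \<in> chains_on (degenerate_tuples 3)"
  shows "dQ c \<in> chains_on diag"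
proof (rule frag_extend_in_chains [OF assms])
  fix xs assume "xs \<in> degenerate_tuples 3"
  then obtain i where xs: "xs \<in> tuples (carrier G) 3" "i < 2" "xs ! i = xs ! Suc i"
    by (auto simp: degenerate_tuples_def)
  from xs(1) show "rack_boundary_tuple Alex xs \<in> chains_on diag"
  proof (rule tuple3E)
    fix x y z assume xyz: "x \<in> carrier G" "y \<in> carrier G" "z \<in> carrier G" "xs = [x, y, z]"
    with xs(2,3) consider "x = y" | "y = z"
      by (auto simp: less_2_cases_iff)
    then show ?thesis
      using xyz by cases (auto simp: rack_boundary_3 diag_def)
  qed
qed

lemma subgroup_degenerate: "subgroup (degenerate_chains Alex n) (T n)"
proof -
  interpret T: comm_group "T n" by (rule comm_group_tuple_chains)
  show ?thesis
    unfolding degenerate_chains_def carrier_gen_Alexander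
    by (rule T.generate_is_subgroup) (auto simp: carrier_tuple_chains)
qed

lemma quandle_chains_eq: "quandle_chains Alex n = T n Mod degenerate_chains Alex n"
  by (simp add: quandle_chains_def)

lemma comm_group_quandle_chains: "comm_group (quandle_chains Alex n)"
  unfolding quandle_chains_eq
  by (rule comm_group.abelian_FactGroup [OF comm_group_tuple_chains subgroup_degenerate])

abbreviation "cl n c \<equiv> degenerate_chains Alex n #>\<^bsub>T n\<^esub> c"

lemma carrier_quandle_chains: "carrier (quandle_chains Alex n) = cl n ` C n"
  by (simp add: quandle_chains_eq carrier_FactGroup carrier_tuple_chains)

lemma cl_hom: "cl n \<in> hom (T n) (quandle_chains Alex n)"
  unfolding quandle_chains_eq
  by (rule coset_map_hom [OF comm_group_tuple_chains subgroup_degenerate])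

lemma quandle_boundary_facts:
  shows quandle_boundary_hom_2:
      "quandle_boundary Alex 2 \<in> hom (quandle_chains Alex 2) (quandle_chains Alex 1)"
    and quandle_boundary_hom_3:
      "quandle_boundary Alex 3 \<in> hom (quandle_chains Alex 3) (quandle_chains Alex 2)"
    and quandle_boundary_2: "c \<in> C 2 \<Longrightarrow> quandle_boundary Alex 2 (cl 2 c) = cl 1 (dQ c)"
    and quandle_boundary_3: "t \<in> C 3 \<Longrightarrow> quandle_boundary Alex 3 (cl 3 t) = cl 2 (dQ t)"
proof -
  have hom2: "dQ \<in> hom (T 2) (T 1)" and hom3: "dQ \<in> hom (T 3) (T 2)"
    using dQ_closed dQ_closed3 by (simp_all add: additive_hom frag_extend_add)
  have deg2: "dQ ` degenerate_chains Alex 2 \<subseteq> degenerate_chains Alex 1"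
    by (auto simp: degenerate_chains_eq degenerate_tuples_2 dQ_diag simp del: One_nat_def)
  have deg3: "dQ ` degenerate_chains Alex 3 \<subseteq> degenerate_chains Alex 2"
    using dQ_degenerate by (auto simp: degenerate_chains_eq degenerate_tuples_2)
  have groups: "group (T n)" for n
    using comm_group_tuple_chains comm_group.axioms(2) by auto
  have eq: "quandle_boundary Alex 2 = Mod_map (T 1) (degenerate_chains Alex 1) dQ"
    "quandle_boundary Alex 3 = Mod_map (T 2) (degenerate_chains Alex 2) dQ"
    by (simp_all add: quandle_boundary_def)
  show "quandle_boundary Alex 2 \<in> hom (quandle_chains Alex 2) (quandle_chains Alex 1)"
    unfolding eq quandle_chains_eq
    by (rule Mod_map_hom [OF comm_group_tuple_chains comm_group_tuple_chains
          subgroup_degenerate subgroup_degenerate hom2 deg2])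
  show "quandle_boundary Alex 3 \<in> hom (quandle_chains Alex 3) (quandle_chains Alex 2)"
    unfolding eq quandle_chains_eq
    by (rule Mod_map_hom [OF comm_group_tuple_chains comm_group_tuple_chains
          subgroup_degenerate subgroup_degenerate hom3 deg3])
  show "quandle_boundary Alex 2 (cl 2 c) = cl 1 (dQ c)" if "c \<in> C 2"
    unfolding eq
    by (rule Mod_map_r_coset [OF groups groups subgroup_degenerate subgroup_degenerate hom2 deg2])
      (simp add: that carrier_tuple_chains)
  show "quandle_boundary Alex 3 (cl 3 t) = cl 2 (dQ t)" if "t \<in> C 3"
    unfolding eq
    by (rule Mod_map_r_coset [OF groups groups subgroup_degenerate subgroup_degenerate hom3 deg3])
      (simp add: that carrier_tuple_chains)
qed

abbreviation "Zq \<equiv> cycles (quandle_chains Alex) (quandle_boundary Alex) 2"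
abbreviation "Bq \<equiv> boundaries (quandle_chains Alex) (quandle_boundary Alex) 2"

lemma boundaries_quandle: "Bq = (\<lambda>t. cl 2 (dQ t)) ` C 3"
proof -
  have "Bq = quandle_boundary Alex 3 ` cl 3 ` C 3"
    by (simp add: boundaries_def carrier_quandle_chains)
  also have "\<dots> = (\<lambda>t. cl 2 (dQ t)) ` C 3"
    unfolding image_image by (rule image_cong) (simp_all add: quandle_boundary_3)
  finally show ?thesis .
qed

lemma cl_1_eq_one: "c \<in> C 1 \<Longrightarrow> cl 1 c = \<one>\<^bsub>quandle_chains Alex 1\<^esub> \<longleftrightarrow> c = 0"
  unfolding quandle_chains_eq
  by (subst coset_map_kernel [OF comm_group_tuple_chains subgroup_degenerate])
    (auto simp: carrier_tuple_chains degenerate_chains_eq degenerate_tuples_1 chains_on_def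
      simp del: One_nat_def)

lemma carrier_Zq: "carrier Zq = cl 2 ` {c \<in> C 2. dQ c = 0}"
proof -
  have "carrier Zq = {U \<in> cl 2 ` C 2. quandle_boundary Alex 2 U = \<one>\<^bsub>quandle_chains Alex 1\<^esub>}"
    by (simp add: cycles_def kernel_def carrier_quandle_chains)
  also have "\<dots> = cl 2 ` {c \<in> C 2. quandle_boundary Alex 2 (cl 2 c) = \<one>\<^bsub>quandle_chains Alex 1\<^esub>}"
    by blast
  also have "{c \<in> C 2. quandle_boundary Alex 2 (cl 2 c) = \<one>\<^bsub>quandle_chains Alex 1\<^esub>} = {c \<in> C 2. dQ c = 0}"
    using quandle_boundary_2 cl_1_eq_one dQ_closed by auto
  finally show ?thesis .
qed

lemma Zq_Bq: shows comm_group_Zq: "comm_group Zq" and subgroup_Bq: "subgroup Bq Zq"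
proof -
  have groups: "group (quandle_chains Alex n)" for n
    using comm_group_quandle_chains comm_group.axioms(2) by auto
  have d: "quandle_boundary Alex 2 \<in> hom (quandle_chains Alex 2) (quandle_chains Alex (2 - 1))"
    "quandle_boundary Alex (Suc 2) \<in> hom (quandle_chains Alex (Suc 2)) (quandle_chains Alex 2)"
    using quandle_boundary_hom_2 quandle_boundary_hom_3 by simp_all
  have dd: "quandle_boundary Alex 2 (quandle_boundary Alex (Suc 2) U) = \<one>\<^bsub>quandle_chains Alex (2 - 1)\<^esub>"
    if U: "U \<in> carrier (quandle_chains Alex (Suc 2))" for U
  proof -
    obtain t where "t \<in> C 3" "U = cl 3 t"
      using U by (auto simp: carrier_quandle_chains)
    then show ?thesis
      using cl_1_eq_one [of 0] by (simp add: quandle_boundary_3 quandle_boundary_2 dQ_closed3 dQ_dQ)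
  qed
  show "comm_group Zq"
    by (rule comm_group_cycles [OF comm_group_quandle_chains groups groups d dd])
  show "subgroup Bq Zq"
    by (rule subgroup_boundaries [OF comm_group_quandle_chains groups groups d dd])
qed

abbreviation "quandle_class c \<equiv> Bq #>\<^bsub>Zq\<^esub> cl 2 c"

lemma quandle_class:
  shows quandle_class_image: "quandle_class ` {c \<in> C 2. dQ c = 0} = carrier (quandle_homology Alex 2)"
    and quandle_class_add: "\<lbrakk>c \<in> C 2; dQ c = 0; c' \<in> C 2; dQ c' = 0\<rbrakk> \<Longrightarrow>
      quandle_class (c + c') = quandle_class c \<otimes>\<^bsub>quandle_homology Alex 2\<^esub> quandle_class c'"
    and quandle_class_one: "\<lbrakk>c \<in> C 2; dQ c = 0\<rbrakk> \<Longrightarrow>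
      quandle_class c = \<one>\<^bsub>quandle_homology Alex 2\<^esub> \<longleftrightarrow> c \<in> BQ"
    and group_quandle_homology: "group (quandle_homology Alex 2)"
proof -
  have H: "quandle_homology Alex 2 = Zq Mod Bq"
    by (simp add: quandle_homology_def homology_def)
  note q = coset_map [OF comm_group_Zq subgroup_Bq, folded H]
  show "quandle_class ` {c \<in> C 2. dQ c = 0} = carrier (quandle_homology Alex 2)"
    unfolding q(2) [symmetric] carrier_Zq by (simp add: image_image)
  show "group (quandle_homology Alex 2)"
    by (rule q(4))
  show "quandle_class (c + c') = quandle_class c \<otimes>\<^bsub>quandle_homology Alex 2\<^esub> quandle_class c'"
    if "c \<in> C 2" "dQ c = 0" "c' \<in> C 2" "dQ c' = 0" for c c'
  proof -
    have Z: "cl 2 c \<in> carrier Zq" "cl 2 c' \<in> carrier Zq"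
      using that by (auto simp: carrier_Zq)
    have "cl 2 (c + c') = cl 2 c \<otimes>\<^bsub>Zq\<^esub> cl 2 c'"
      using hom_mult [OF cl_hom, of c 2 c'] that by (simp add: carrier_tuple_chains cycles_def)
    then show ?thesis
      using hom_mult [OF q(1) Z] by simp
  qed
  show "quandle_class c = \<one>\<^bsub>quandle_homology Alex 2\<^esub> \<longleftrightarrow> c \<in> BQ" if c: "c \<in> C 2" "dQ c = 0" for c
  proof -
    have "cl 2 c \<in> carrier Zq"
      using c by (auto simp: carrier_Zq)
    then have "quandle_class c = \<one>\<^bsub>quandle_homology Alex 2\<^esub> \<longleftrightarrow> cl 2 c \<in> Bq"
      by (rule q(3))
    also have "\<dots> \<longleftrightarrow> (\<exists>t \<in> C 3. cl 2 c = cl 2 (dQ t))"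
      unfolding boundaries_quandle by blast
    also have "\<dots> \<longleftrightarrow> (\<exists>t \<in> C 3. c - dQ t \<in> chains_on diag)"
      by (rule bex_cong [OF refl], subst coset_eq_iff [OF subgroup_degenerate])
        (use c dQ_closed3 in \<open>simp_all add: degenerate_chains_eq degenerate_tuples_2\<close>)
    also have "\<dots> \<longleftrightarrow> c \<in> BQ"
    proof
      assume "\<exists>t \<in> C 3. c - dQ t \<in> chains_on diag"
      then obtain t where t: "t \<in> C 3" "c - dQ t \<in> chains_on diag"
        by blast
      show "c \<in> BQ"
        using BQ_I [OF t] by simp
    next
      assume "c \<in> BQ"
      then obtain t e where "t \<in> C 3" "e \<in> chains_on diag" "c = dQ t + e"
        by (rule BQ_E)
      then show "\<exists>t \<in> C 3. c - dQ t \<in> chains_on diag"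
        by (intro bexI [of _ t]) simp_all
    qed
    finally show ?thesis .
  qed
qed

end

section \<open>The isomorphism\<close>

context connected_group_automorphism
begin

theorem quandle_homology_iso_coinvariants:
  assumes "one_minus (abelianization G) (abelianization_map G \<phi>)
      \<in> iso (abelianization G) (abelianization G)"
  shows "quandle_homology Alex 2 \<cong> coinvariants (group_homology G 2) (group_homology_map G 2 \<phi>)"
proof (rule iso_of_equal_kernels [of Zg _ _ "\<lambda>u. quandle_class (loop u)" coinvariant_class])
  have loop_Z: "loop u \<in> C 2" "dQ (loop u) = 0" if "u \<in> carrier Zg" for u
    using that loop_cycle by (simp_all add: carrier_Zg)
  have in_carrier: "quandle_class c \<in> carrier (quandle_homology Alex 2)" if "c \<in> C 2" "dQ c = 0" for c
    using that quandle_class_image by blast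
  show "(\<lambda>u. quandle_class (loop u)) \<in> hom Zg (quandle_homology Alex 2)"
  proof (rule homI)
    fix u v assume uv: "u \<in> carrier Zg" "v \<in> carrier Zg"
    show "quandle_class (loop u) \<in> carrier (quandle_homology Alex 2)"
      using loop_Z [OF uv(1)] by (rule in_carrier)
    show "quandle_class (loop (u \<otimes>\<^bsub>Zg\<^esub> v)) =
        quandle_class (loop u) \<otimes>\<^bsub>quandle_homology Alex 2\<^esub> quandle_class (loop v)"
      using quandle_class_add [OF loop_Z [OF uv(1)] loop_Z [OF uv(2)]] by (simp add: frag_extend_add)
  qed
  show "(\<lambda>u. quandle_class (loop u)) ` carrier Zg = carrier (quandle_homology Alex 2)"
  proof
    show "(\<lambda>u. quandle_class (loop u)) ` carrier Zg \<subseteq> carrier (quandle_homology Alex 2)"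
      using in_carrier loop_Z by blast
    show "carrier (quandle_homology Alex 2) \<subseteq> (\<lambda>u. quandle_class (loop u)) ` carrier Zg"
    proof
      fix h assume "h \<in> carrier (quandle_homology Alex 2)"
      then obtain c where c: "c \<in> C 2" "dQ c = 0" "h = quandle_class c"
        unfolding quandle_class_image [symmetric] by blast
      obtain u where u: "u \<in> C 2" "dG u = 0" "c - loop u \<in> BQ"
        using loop_surjective [OF assms c(1,2)] by blast
      have diff: "c - loop u \<in> C 2" "dQ (c - loop u) = 0"
        using BQ_cycle [OF u(3)] by auto
      have "quandle_class c = quandle_class ((c - loop u) + loop u)"
        by simp
      also have "\<dots> = quandle_class (c - loop u) \<otimes>\<^bsub>quandle_homology Alex 2\<^esub> quandle_class (loop u)"
        using diff loop_cycle [OF u(1)] by (rule quandle_class_add)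
      also have "quandle_class (c - loop u) = \<one>\<^bsub>quandle_homology Alex 2\<^esub>"
        using quandle_class_one [OF diff] u(3) by blast
      also have "\<dots> \<otimes>\<^bsub>quandle_homology Alex 2\<^esub> quandle_class (loop u) = quandle_class (loop u)"
        using group.is_monoid [OF group_quandle_homology] in_carrier [OF loop_cycle [OF u(1)]]
        by (rule monoid.l_one)
      finally show "h \<in> (\<lambda>u. quandle_class (loop u)) ` carrier Zg"
        using u c(3) by (auto simp: carrier_Zg)
    qed
  qed
  fix u assume u: "u \<in> carrier Zg"
  then have "loop u \<in> BQ \<longleftrightarrow> (\<exists>z \<in> carrier Zg. u - (z - push \<phi> z) \<in> BG)"
    using loop_kernel [of u] by (auto simp: carrier_Zg)
  then show "quandle_class (loop u) = \<one>\<^bsub>quandle_homology Alex 2\<^esub> \<longleftrightarrow>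
      coinvariant_class u = \<one>\<^bsub>coinvariants Hg phi_H\<^esub>"
    using quandle_class_one [OF loop_Z [OF u]] coinvariant_class_one [OF u] by blast
qed (use comm_group_Zg group_quandle_homology group_coinvariants coinvariant_class_hom
      coinvariant_class_image in \<open>simp_all add: comm_group_def\<close>)

end

theorem theorem1p2:
  fixes G :: "('a, 'b) monoid_scheme" and \<phi> :: "'a \<Rightarrow> 'a"
  assumes "group G"
    and "\<phi> \<in> iso G G"
    and "connected_quandle (gen_Alexander G \<phi>)"
    and "one_minus (abelianization G) (abelianization_map G \<phi>)
           \<in> iso (abelianization G) (abelianization G)"
  shows "quandle_homology (gen_Alexander G \<phi>) 2
           \<cong> coinvariants (group_homology G 2) (group_homology_map G 2 \<phi>)"
proof -
  interpret connected_group_automorphism G \<phi>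
    using assms(1-3)
    by (simp add: connected_group_automorphism_def connected_group_automorphism_axioms_def
        group_automorphism_def group_automorphism_axioms_def)
  show ?thesis
    using assms(4) by (rule quandle_homology_iso_coinvariants)
qed

end
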